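(* Let $\Sigma$ be a $\mathrm{UNFO}$-theory in a relational signature $\sigma$, let $R\in\sigma$ be a relation symbol and $\tau\subseteq\sigma$. If $\Sigma$ implicitly defines $R$ in terms of $\tau$, then there is a $\mathrm{UNFO}$ formula $\phi(\bar x)$ in signature $\tau$ that is an explicit definition of $R$ relative to $\Sigma$. Moreover, if $\Sigma$ consists of $\mathrm{UNFO}^k$ sentences ($k\geq 1$), then such an explicit definition can be found in $\mathrm{UNFO}^k$.
   Context: $\mathrm{UNFO}$ is the set of first-order formulas generated by $\phi ::= R(\bar x)\mid x=y\mid \phi\wedge\phi\mid\phi\vee\phi\mid\exists x\,\phi\mid\neg\phi$, where in the last clause $\phi$ has at most one free variable; a $\mathrm{UNFO}$-theory is a set of $\mathrm{UNFO}$ sentences. A formula is in UN-normal form if every existential quantifier in its syntax tree, except at the root, either is directly below another existential quantifier or starts a subformula with at most one free variable; formulas are put in UN-normal form by the rules $\phi\wedge\exists x\psi\equiv\exists x(\phi\wedge\psi)$, $\phi\vee\exists x\psi\equiv\exists x(\phi\vee\psi)$ ($x$ not free in $\phi$), with renaming of bound variables. A formula has width $k$ if it can be put in UN-normal form this way using at most $k$ variables; $\mathrm{UNFO}^k$ is the set of such formulas. $\Sigma$ implicitly defines $R$ in terms of $\tau$ if for every $\tau$-structure $M$ and all $\sigma$-expansions $M_1,M_2$ of $M$ satisfying $\Sigma$, $R^{M_1}=R^{M_2}$. A formula $\phi(\bar x)$ in signature $\tau$ is an explicit definition of $R$ relative to $\Sigma$ if $\Sigma\models\forall\bar x\,(R\bar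 x\leftrightarrow\phi(\bar x))$.
   Formalization: The "moreover" part additionally assumes arity(R) ≤ k when R ∈ τ (it is false otherwise: Σ empty, R binary in τ, k = 1). Structures range over subsets of one infinite set at least as large as σ, which suffices by downward Löwenheim–Skolem. *)

theory Defs
  imports Main "HOL-Library.Equipollence"
begin

text \<open>First-order formulas over relation symbols of type \<open>'r\<close>, with variables named by natural
  numbers. A relational signature is a set of relation symbols, the arities being given by a
  function \<open>ar\<close> that is shared by all signatures; arity 0 is allowed.\<close>

datatype 'r fm =
    Rel 'r "nat list"
  | Eq nat nat
  | And "'r fm" "'r fm"
  | Or "'r fm" "'r fm"
  | Ex nat "'r fm"
  | Neg "'r fm"

primrec fv :: "'r fm \<Rightarrow> nat set" where
  "fv (Rel S xs) = set xs"
| "fv (Eq x y) = {x, y}"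
| "fv (And p q) = fv p \<union> fv q"
| "fv (Or p q) = fv p \<union> fv q"
| "fv (Ex x p) = fv p - {x}"
| "fv (Neg p) = fv p"

text \<open>All variables occurring in a formula, free or bound, including a variable that occurs only
  next to its quantifier.\<close>

primrec vars :: "'r fm \<Rightarrow> nat set" where
  "vars (Rel S xs) = set xs"
| "vars (Eq x y) = {x, y}"
| "vars (And p q) = vars p \<union> vars q"
| "vars (Or p q) = vars p \<union> vars q"
| "vars (Ex x p) = insert x (vars p)"
| "vars (Neg p) = vars p"

inductive_set UNFO :: "('r \<Rightarrow> nat) \<Rightarrow> 'r set \<Rightarrow> 'r fm set"
  for ar :: "'r \<Rightarrow> nat" and sig :: "'r set" where
  "S \<in> sig \<Longrightarrow> length xs = ar S \<Longrightarrow> Rel S xs \<in> UNFO ar sig"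
| "Eq x y \<in> UNFO ar sig"
| "p \<in> UNFO ar sig \<Longrightarrow> q \<in> UNFO ar sig \<Longrightarrow> And p q \<in> UNFO ar sig"
| "p \<in> UNFO ar sig \<Longrightarrow> q \<in> UNFO ar sig \<Longrightarrow> Or p q \<in> UNFO ar sig"
| "p \<in> UNFO ar sig \<Longrightarrow> Ex x p \<in> UNFO ar sig"
| "p \<in> UNFO ar sig \<Longrightarrow> card (fv p) \<le> 1 \<Longrightarrow> Neg p \<in> UNFO ar sig"

text \<open>The flag tells whether the current node is exempt from the restriction on free variables,
  that is, whether it is the root or directly below an existential quantifier.\<close>

primrec un_normal_at :: "bool \<Rightarrow> 'r fm \<Rightarrow> bool" where
  "un_normal_at b (Rel S xs) = True"
| "un_normal_at b (Eq x y) = True"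
| "un_normal_at b (And p q) = (un_normal_at False p \<and> un_normal_at False q)"
| "un_normal_at b (Or p q) = (un_normal_at False p \<and> un_normal_at False q)"
| "un_normal_at b (Ex x p) = ((b \<or> card (fv (Ex x p)) \<le> 1) \<and> un_normal_at True p)"
| "un_normal_at b (Neg p) = un_normal_at False p"

definition un_normal :: "'r fm \<Rightarrow> bool" where
  "un_normal p = un_normal_at True p"

text \<open>Replaces the free occurrences of \<open>x\<close> by \<open>y\<close>; used only when \<open>y\<close> does not occur at all in
  the formula, so that no capture can happen.\<close>

primrec rename_free :: "nat \<Rightarrow> nat \<Rightarrow> 'r fm \<Rightarrow> 'r fm" where
  "rename_free x y (Rel S xs) = Rel S (map (\<lambda>z. if z = x then y else z) xs)"
| "rename_free x y (Eq u v) = Eq (if u = x then y else u) (if v = x then y else v)"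
| "rename_free x y (And p q) = And (rename_free x y p) (rename_free x y q)"
| "rename_free x y (Or p q) = Or (rename_free x y p) (rename_free x y q)"
| "rename_free x y (Ex z p) = (if z = x then Ex z p else Ex z (rename_free x y p))"
| "rename_free x y (Neg p) = Neg (rename_free x y p)"

text \<open>One step of pulling out an existential quantifier, or of renaming a bound variable, at an
  arbitrary position. Conjunction and disjunction being commutative, a quantifier may be pulled
  out of either argument. Renamings to fresh variables generate all renamings of bound
  variables: one can first make all bound variables distinct and fresh, and then give them their
  final names from the outside in.\<close>

inductive pull_step :: "'r fm \<Rightarrow> 'r fm \<Rightarrow> bool" where
  "x \<notin> fv p \<Longrightarrow> pull_step (And p (Ex x q)) (Ex x (And p q))"
| "x \<notin> fv p \<Longrightarrow> pull_step (And (Ex x q) p) (Ex x (And q p))"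
| "x \<notin> fv p \<Longrightarrow> pull_step (Or p (Ex x q)) (Ex x (Or p q))"
| "x \<notin> fv p \<Longrightarrow> pull_step (Or (Ex x q) p) (Ex x (Or q p))"
| "y \<notin> vars p \<Longrightarrow> pull_step (Ex x p) (Ex y (rename_free x y p))"
| "pull_step p p' \<Longrightarrow> pull_step (And p q) (And p' q)"
| "pull_step q q' \<Longrightarrow> pull_step (And p q) (And p q')"
| "pull_step p p' \<Longrightarrow> pull_step (Or p q) (Or p' q)"
| "pull_step q q' \<Longrightarrow> pull_step (Or p q) (Or p q')"
| "pull_step p p' \<Longrightarrow> pull_step (Ex x p) (Ex x p')"
| "pull_step p p' \<Longrightarrow> pull_step (Neg p) (Neg p')"

definition has_width :: "nat \<Rightarrow> 'r fm \<Rightarrow> bool" where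
  "has_width k p \<longleftrightarrow> (\<exists>q. pull_step\<^sup>*\<^sup>* p q \<and> un_normal q \<and> card (vars q) \<le> k)"

definition UNFO_width :: "('r \<Rightarrow> nat) \<Rightarrow> 'r set \<Rightarrow> nat \<Rightarrow> 'r fm set" where
  "UNFO_width ar sig k = {p \<in> UNFO ar sig. has_width k p}"

definition UNFO_theory :: "('r \<Rightarrow> nat) \<Rightarrow> 'r set \<Rightarrow> 'r fm set \<Rightarrow> bool" where
  "UNFO_theory ar sig T \<longleftrightarrow> T \<subseteq> {p \<in> UNFO ar sig. fv p = {}}"

datatype ('u, 'r) struc =
  Struc (universe: "'u set") (interp: "'r \<Rightarrow> 'u list set")

text \<open>The interpretation of symbols outside the signature is irrelevant.\<close>

definition is_structure :: "('r \<Rightarrow> nat) \<Rightarrow> 'r set \<Rightarrow> ('u, 'r) struc \<Rightarrow> bool" where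
  "is_structure ar sig M \<longleftrightarrow> universe M \<noteq> {} \<and>
     (\<forall>S\<in>sig. interp M S \<subseteq> {as. length as = ar S \<and> set as \<subseteq> universe M})"

primrec sat :: "('u, 'r) struc \<Rightarrow> (nat \<Rightarrow> 'u) \<Rightarrow> 'r fm \<Rightarrow> bool" where
  "sat M s (Rel S xs) \<longleftrightarrow> map s xs \<in> interp M S"
| "sat M s (Eq x y) \<longleftrightarrow> s x = s y"
| "sat M s (And p q) \<longleftrightarrow> sat M s p \<and> sat M s q"
| "sat M s (Or p q) \<longleftrightarrow> sat M s p \<or> sat M s q"
| "sat M s (Ex x p) \<longleftrightarrow> (\<exists>a\<in>universe M. sat M (s(x := a)) p)"
| "sat M s (Neg p) \<longleftrightarrow> \<not> sat M s p"

definition is_model :: "('u, 'r) struc \<Rightarrow> 'r fm set \<Rightarrow> bool" where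
  "is_model M T \<longleftrightarrow> (\<forall>p\<in>T. \<forall>s. range s \<subseteq> universe M \<longrightarrow> sat M s p)"

definition is_expansion ::
  "('r \<Rightarrow> nat) \<Rightarrow> 'r set \<Rightarrow> 'r set \<Rightarrow> ('u, 'r) struc \<Rightarrow> ('u, 'r) struc \<Rightarrow> bool" where
  "is_expansion ar sig tau N M \<longleftrightarrow> is_structure ar sig N \<and> universe N = universe M \<and>
     (\<forall>S\<in>tau. interp N S = interp M S)"

text \<open>HOL cannot quantify over all types inside a formula, so the structures considered are those
  whose universe is a nonempty subset of a type \<open>'u\<close>, passed as an argument. If \<open>'u\<close> is infinite and
  at least as large as the signature, then by the downward Loewenheim-Skolem theorem both notions
  below agree with those obtained by considering structures of any size.\<close>

definition implicitly_defines ::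
  "'u itself \<Rightarrow> ('r \<Rightarrow> nat) \<Rightarrow> 'r set \<Rightarrow> 'r fm set \<Rightarrow> 'r \<Rightarrow> 'r set \<Rightarrow> bool" where
  "implicitly_defines U ar sig T R tau \<longleftrightarrow>
     (\<forall>(M :: ('u, 'r) struc) M1 M2. is_structure ar tau M \<longrightarrow>
        is_expansion ar sig tau M1 M \<longrightarrow> is_expansion ar sig tau M2 M \<longrightarrow>
        is_model M1 T \<longrightarrow> is_model M2 T \<longrightarrow> interp M1 R = interp M2 R)"

text \<open>\<open>p\<close>, as a formula in the tuple of variables \<open>xs\<close>, explicitly defines \<open>R\<close> relative to \<open>T\<close>.
  That \<open>p\<close> is a formula of the smaller signature is not part of this definition.\<close>

definition explicit_definition ::
  "'u itself \<Rightarrow> ('r \<Rightarrow> nat) \<Rightarrow> 'r set \<Rightarrow> 'r fm set \<Rightarrow> 'r \<Rightarrow> nat list \<Rightarrow> 'r fm \<Rightarrow> bool" where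
  "explicit_definition U ar sig T R xs p \<longleftrightarrow>
     distinct xs \<and> length xs = ar R \<and> fv p \<subseteq> set xs \<and>
     (\<forall>M :: ('u, 'r) struc. is_structure ar sig M \<longrightarrow> is_model M T \<longrightarrow>
        (\<forall>s. range s \<subseteq> universe M \<longrightarrow> (sat M s (Rel R xs) \<longleftrightarrow> sat M s p)))"

end

theory Submission imports Defs "HOL-Combinatorics.Transposition" begin

text \<open>A structure \<open>A\<close> with a homomorphism onto a model \<open>M\<close> is again a model as soon as every small
  set of elements of \<open>M\<close> can be lifted homomorphically to \<open>A\<close> through any given preimage of one of
  its elements. Two constructions exploit this freedom. If \<open>R\<close> is not in \<open>tau\<close> and has arity at least
  two, then in two disjoint copies of a model a tuple of \<open>R\<close> can be repeated across the copies, so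
  an implicitly definable \<open>R\<close> is empty and the explicit definition is a contradiction. If the
  arity is at most one and no definition exists, there are for every finite \<open>F \<subseteq> tau\<close> and every
  depth \<open>n\<close> two models, with points on which \<open>R\<close> differs, that agree on the finitely many formulas
  of depth \<open>n\<close> over \<open>F\<close>. In ultraproducts \<open>M\<close> and \<open>N\<close> of these models the finite levels of agreement
  become a genuine back-and-forth system \<open>Z\<close>, and on the pairs \<open>(c, d)\<close> with \<open>Z c d\<close> one places two
  structures with the same \<open>tau\<close>-part: one otherwise copies \<open>M\<close>, the other copies \<open>N\<close>. Both are
  models, contradicting implicit definability; a Loewenheim-Skolem argument brings them down to
  the type \<open>'u\<close>.\<close>

section \<open>Renaming, pulling quantifiers and finite conjunctions\<close>

text \<open>The split by arity comes from unary negation. With at most one free variable, formulas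
  may be negated, so once finitely many formulas decide \<open>R\<close>, it is defined by a
  disjunction of complete types. The obstacle is that formulas assert atoms on several elements
  without being able to deny them. Agreement of two models therefore yields only local
  homomorphisms, neither injective nor reflecting atoms, and each use of it costs one level of
  depth. Finite agreement is thus not closed under steps; in an ultraproduct a finite loss is
  harmless. Width enters through normal forms: a block of quantifiers over \<open>k\<close> variable
  names needs at most \<open>k\<close> elements lifted at once. Both claims of the theorem share one
  argument, in which \<open>\<kappa> n\<close> is the width used at depth \<open>n\<close>:
  constantly \<open>k\<close> for bounded width, and \<open>Suc n\<close> for the general
  claim.\<close>

lemma finite_fv [simp]: "finite (fv p)"
  by (induction p) auto

lemma finite_vars [simp]: "finite (vars p)"
  by (induction p) auto

lemma fv_subset_vars: "fv p \<subseteq> vars p"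
  by (induction p) auto

lemma fv_unary:
  assumes "card (fv p) \<le> 1"
  obtains x where "fv p \<subseteq> {x}"
proof (cases "fv p = {}")
  case False
  then have "card (fv p) = 1"
    using assms by (simp add: Suc_leI card_gt_0_iff le_antisym)
  then show thesis
    using that by (metis card_1_singletonE subset_refl)
qed (use that in simp)

lemma sat_cong:
  assumes "\<And>x. x \<in> fv p \<Longrightarrow> s x = t x"
  shows "sat M s p \<longleftrightarrow> sat M t p"
  using assms
proof (induction p arbitrary: s t)
  case (Rel S xs)
  then have "map s xs = map t xs" by simp
  then show ?case by (metis sat.simps(1))
next
  case (And p q)
  then show ?case by (metis UnI1 UnI2 fv.simps(3) sat.simps(3))
next
  case (Or p q)
  then show ?case by (metis UnI1 UnI2 fv.simps(4) sat.simps(4))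
next
  case (Ex x p)
  have "sat M (s(x := a)) p \<longleftrightarrow> sat M (t(x := a)) p" for a
    by (rule Ex.IH) (use Ex.prems in auto)
  then show ?case by simp
next
  case (Neg p)
  have "sat M s p \<longleftrightarrow> sat M t p"
    by (rule Neg.IH) (use Neg.prems in auto)
  then show ?case by simp
qed simp

lemma sat_upd_irrelevant: "x \<notin> fv p \<Longrightarrow> sat M (s(x := a)) p \<longleftrightarrow> sat M s p"
  by (rule sat_cong) auto

primrec ren :: "(nat \<Rightarrow> nat) \<Rightarrow> 'r fm \<Rightarrow> 'r fm" where
  "ren f (Rel S xs) = Rel S (map f xs)"
| "ren f (Eq x y) = Eq (f x) (f y)"
| "ren f (And p q) = And (ren f p) (ren f q)"
| "ren f (Or p q) = Or (ren f p) (ren f q)"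
| "ren f (Ex x p) = Ex (f x) (ren f p)"
| "ren f (Neg p) = Neg (ren f p)"

lemma fv_ren: "inj f \<Longrightarrow> fv (ren f p) = f ` fv p"
  by (induction p) (auto simp: inj_eq)

lemma vars_ren: "vars (ren f p) = f ` vars p"
  by (induction p) auto

lemma sat_ren: "inj f \<Longrightarrow> sat M s (ren f p) \<longleftrightarrow> sat M (s \<circ> f) p"
proof (induction p arbitrary: s)
  case (Ex x p)
  have "s(f x := a) \<circ> f = (s \<circ> f)(x := a)" for a
    using Ex.prems by (auto simp: inj_eq)
  then show ?case by (simp only: ren.simps sat.simps Ex.IH [OF Ex.prems])
qed auto

lemma card_fv_ren: "inj f \<Longrightarrow> card (fv (ren f p)) = card (fv p)"
  by (simp add: fv_ren card_image inj_on_subset)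

lemma UNFO_ren: "inj f \<Longrightarrow> p \<in> UNFO ar sig \<Longrightarrow> ren f p \<in> UNFO ar sig"
proof (rotate_tac, induction rule: UNFO.induct)
  case (6 p)
  then show ?case
    by (auto simp: card_fv_ren intro: UNFO.intros)
qed (auto intro: UNFO.intros)

lemma un_normal_at_ren: "inj f \<Longrightarrow> un_normal_at b (ren f p) = un_normal_at b p"
proof (induction p arbitrary: b)
  case (Ex x p)
  then show ?case using card_fv_ren [of f "Ex x p"] by simp
qed auto

lemma un_normal_at_mono: "un_normal_at False p \<Longrightarrow> un_normal_at b p"
  by (cases p) auto

text \<open>The final conjunct is a closed truth mentioning only the variable \<open>0\<close>.
  Being closed, it remains usable when no free variable is allowed, and it adds no variable name
  beyond \<open>0\<close>. \<open>Disj\<close> ends in its negation.\<close>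

definition Conj :: "'r fm set \<Rightarrow> 'r fm" where
  "Conj L = foldr And (SOME ps. set ps = L) (Ex 0 (Eq 0 0))"

definition Disj :: "'r fm set \<Rightarrow> 'r fm" where
  "Disj L = foldr Or (SOME ps. set ps = L) (Neg (Ex 0 (Eq 0 0)))"

text \<open>Signature, variable bounds and normality are carried together as one invariant,
  whichever enumeration \<open>SOME\<close> picks.\<close>

lemma foldr_closed:
  assumes "finite L" "P z" "\<And>p. p \<in> L \<Longrightarrow> P p" "\<And>p q. P p \<Longrightarrow> P q \<Longrightarrow> P (f p q)"
  shows "P (foldr f (SOME ps. set ps = L) z)"
proof -
  have "set (SOME ps. set ps = L) = L"
    using finite_list [OF assms(1)] by (rule someI_ex)
  moreover have "set ps \<subseteq> L \<Longrightarrow> P (foldr f ps z)" for ps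
    by (induction ps) (use assms in auto)
  ultimately show ?thesis by blast
qed

lemma Conj_closed:
  assumes "finite L" "P (Ex 0 (Eq 0 0))" "\<And>p. p \<in> L \<Longrightarrow> P p" "\<And>p q. P p \<Longrightarrow> P q \<Longrightarrow> P (And p q)"
  shows "P (Conj L)"
  using assms unfolding Conj_def by (rule foldr_closed)

lemma Disj_closed:
  assumes "finite L" "P (Neg (Ex 0 (Eq 0 0)))" "\<And>p. p \<in> L \<Longrightarrow> P p"
    "\<And>p q. P p \<Longrightarrow> P q \<Longrightarrow> P (Or p q)"
  shows "P (Disj L)"
  using assms unfolding Disj_def by (rule foldr_closed)

lemma sat_Conj:
  assumes "finite L" "universe M \<noteq> {}"
  shows "sat M s (Conj L) \<longleftrightarrow> (\<forall>p\<in>L. sat M s p)"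
proof -
  have "set (SOME ps. set ps = L) = L"
    using finite_list [OF assms(1)] by (rule someI_ex)
  moreover have "sat M s (foldr And ps (Ex 0 (Eq 0 0))) \<longleftrightarrow> (\<forall>p\<in>set ps. sat M s p)" for ps
    using assms(2) by (induction ps) auto
  ultimately show ?thesis unfolding Conj_def by metis
qed

lemma sat_Disj:
  assumes "finite L" "universe M \<noteq> {}"
  shows "sat M s (Disj L) \<longleftrightarrow> (\<exists>p\<in>L. sat M s p)"
proof -
  have "set (SOME ps. set ps = L) = L"
    using finite_list [OF assms(1)] by (rule someI_ex)
  moreover have "sat M s (foldr Or ps (Neg (Ex 0 (Eq 0 0)))) \<longleftrightarrow> (\<exists>p\<in>set ps. sat M s p)" for ps
    using assms(2) by (induction ps) auto
  ultimately show ?thesis unfolding Disj_def by metis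
qed

lemma UNFO_false: "Neg (Ex 0 (Eq 0 0)) \<in> UNFO ar sig"
  by (intro UNFO.intros) simp

section \<open>Quantifier blocks and soundness of pulling quantifiers\<close>

abbreviation exs :: "nat list \<Rightarrow> 'r fm \<Rightarrow> 'r fm" where
  "exs ys p \<equiv> foldr Ex ys p"

lemma sat_exs:
  "sat M s (exs ys p) \<longleftrightarrow>
    (\<exists>t. (\<forall>y\<in>set ys. t y \<in> universe M) \<and> (\<forall>y. y \<notin> set ys \<longrightarrow> t y = s y) \<and> sat M t p)"
proof (induction ys arbitrary: s)
  case Nil
  have "(\<forall>y. t y = s y) \<longleftrightarrow> t = s" for t by auto
  then show ?case by auto
next
  case (Cons y ys)
  show ?case (is "?L \<longleftrightarrow> ?R")
  proof
    assume ?L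
    then obtain a t where "a \<in> universe M" "\<forall>y\<in>set ys. t y \<in> universe M"
      "\<forall>z. z \<notin> set ys \<longrightarrow> t z = (s(y := a)) z" "sat M t p"
      using Cons by auto
    then show ?R by (intro exI [of _ t]) (auto split: if_splits)
  next
    assume ?R
    then obtain t where t: "\<forall>y\<in>set (y # ys). t y \<in> universe M"
      "\<forall>z. z \<notin> set (y # ys) \<longrightarrow> t z = s z" "sat M t p"
      by blast
    then have "sat M (s(y := t y)) (exs ys p)"
      unfolding Cons by (intro exI [of _ t]) auto
    then show ?L using t by auto
  qed
qed

lemma fv_exs: "fv (exs ys p) = fv p - set ys"
  by (induction ys) auto

lemma vars_exs: "vars (exs ys p) = set ys \<union> vars p"
  by (induction ys) auto

lemma UNFO_exs: "p \<in> UNFO ar sig \<Longrightarrow> exs ys p \<in> UNFO ar sig"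
  by (induction ys) (auto intro: UNFO.intros)

lemma un_normal_at_exs:
  assumes "un_normal_at False p" "b \<or> card (fv (exs ys p)) \<le> 1"
  shows "un_normal_at b (exs ys p)"
  using assms(2)
proof (induction ys arbitrary: b)
  case (Cons y ys)
  then show ?case by (simp del: One_nat_def)
qed (use assms(1) un_normal_at_mono in auto)

lemma sat_rename_free: "y \<notin> vars p \<Longrightarrow> sat M s (rename_free x y p) \<longleftrightarrow> sat M (s(x := s y)) p"
proof (induction p arbitrary: s)
  case (Rel S xs)
  have "map (s \<circ> (\<lambda>z. if z = x then y else z)) xs = map (s(x := s y)) xs"
    by auto
  then show ?case by (simp only: rename_free.simps sat.simps map_map)
next
  case (Ex z p)
  have y: "y \<noteq> z" "y \<notin> vars p" using Ex.prems by auto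
  show ?case
  proof (cases "z = x")
    case False
    then have "(s(z := a))(x := (s(z := a)) y) = (s(x := s y))(z := a)" for a
      using y by auto
    then show ?thesis
      using False by (simp only: rename_free.simps sat.simps Ex.IH [OF y(2)] if_False)
  qed (simp only: rename_free.simps sat.simps fun_upd_upd simp_thms if_True)
qed auto

lemma fv_rename_free:
  "y \<notin> vars p \<Longrightarrow> fv (rename_free x y p) = (if x \<in> fv p then insert y (fv p - {x}) else fv p)"
  by (induction p) auto

lemma UNFO_rename_free:
  "p \<in> UNFO ar sig \<Longrightarrow> y \<notin> vars p \<Longrightarrow> rename_free x y p \<in> UNFO ar sig"
proof (induction rule: UNFO.induct)
  case (6 p)
  have "card (fv (rename_free x y p)) \<le> card (fv p)"
    using card_insert_le_m1 [of "card (fv p)" "fv p - {x}" y] 6 card_Suc_Diff1 [of "fv p" x]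
    by (auto simp: fv_rename_free card_insert_if)
  with 6 show ?case by (auto intro: UNFO.intros)
qed (auto intro: UNFO.intros)

lemma pull_step_fv: "pull_step p q \<Longrightarrow> fv q = fv p"
proof (induction rule: pull_step.induct)
  case (5 y p x)
  then show ?case using fv_subset_vars [of p] by (auto simp: fv_rename_free)
qed auto

text \<open>A nonempty universe matters for disjunctions: when \<open>Or p (Ex x q)\<close> holds
  because of \<open>p\<close> alone, the pulled quantifier still needs some element.\<close>

lemma pull_step_sat: "pull_step p q \<Longrightarrow> universe M \<noteq> {} \<Longrightarrow> sat M s q \<longleftrightarrow> sat M s p"
proof (induction arbitrary: s rule: pull_step.induct)
  case (5 y p x)
  have "sat M (s(y := a)) (rename_free x y p) \<longleftrightarrow> sat M (s(x := a)) p" for a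
    unfolding sat_rename_free [OF 5(1)] using 5(1) fv_subset_vars [of p] 
    by (intro sat_cong) auto
  then show ?case by simp
qed (auto simp: sat_upd_irrelevant)

inductive_cases UNFO_AndE: "And p q \<in> UNFO ar sig"
inductive_cases UNFO_OrE: "Or p q \<in> UNFO ar sig"
inductive_cases UNFO_ExE: "Ex x p \<in> UNFO ar sig"
inductive_cases UNFO_NegE: "Neg p \<in> UNFO ar sig"

lemma pull_step_UNFO: "pull_step p q \<Longrightarrow> p \<in> UNFO ar sig \<Longrightarrow> q \<in> UNFO ar sig"
proof (induction rule: pull_step.induct)
  case (11 p p')
  then show ?case using pull_step_fv [of p p'] by (auto elim!: UNFO_NegE intro: UNFO.intros)
qed (auto elim!: UNFO_AndE UNFO_OrE UNFO_ExE intro!: UNFO.intros UNFO_rename_free)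

lemma pull_steps:
  assumes "pull_step\<^sup>*\<^sup>* p q"
  shows "fv q = fv p" and "p \<in> UNFO ar sig \<Longrightarrow> q \<in> UNFO ar sig"
    and "universe M \<noteq> {} \<Longrightarrow> sat M s q \<longleftrightarrow> sat M s p"
  using assms
  by (induction rule: rtranclp_induct) (auto simp: pull_step_fv pull_step_sat intro: pull_step_UNFO)

section \<open>Preservation under coverings\<close>

text \<open>A local section of \<open>\<pi>\<close> that preserves tuples. It is total with values
  in \<open>universe A\<close>, so that \<open>h \<circ> s\<close> is an assignment in
  \<open>A\<close> even where \<open>s\<close> leaves \<open>X\<close>.\<close>

definition lifts ::
  "'r set \<Rightarrow> ('a \<Rightarrow> 'b) \<Rightarrow> ('a, 'r) struc \<Rightarrow> ('b, 'r) struc \<Rightarrow> 'b set \<Rightarrow> ('b \<Rightarrow> 'a) \<Rightarrow> bool" where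
  "lifts sig \<pi> A M X h \<longleftrightarrow> (\<forall>x. h x \<in> universe A) \<and> (\<forall>x\<in>X. \<pi> (h x) = x) \<and>
     (\<forall>S\<in>sig. \<forall>ys\<in>interp M S. set ys \<subseteq> X \<longrightarrow> map h ys \<in> interp A S)"

text \<open>The prescribed preimage \<open>e\<close> is the value of the single free variable below
  a negation: it stays fixed while everything else is lifted afresh. Prescribing two preimages would
  ask too much, for instance if they lie in different copies of a model.\<close>

definition covers ::
  "'r set \<Rightarrow> nat \<Rightarrow> ('a \<Rightarrow> 'b) \<Rightarrow> ('a, 'r) struc \<Rightarrow> ('b, 'r) struc \<Rightarrow> bool" where
  "covers sig k \<pi> A M \<longleftrightarrow> universe A \<noteq> {} \<and> \<pi> ` universe A = universe M \<and>
     (\<forall>S\<in>sig. \<forall>as\<in>interp A S. map \<pi> as \<in> interp M S) \<and>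
     (\<forall>X e. finite X \<and> X \<subseteq> universe M \<and> card X \<le> k \<and> e \<in> universe A \<and> \<pi> e \<in> X \<longrightarrow>
        (\<exists>h. h (\<pi> e) = e \<and> lifts sig \<pi> A M X h))"

lemma liftsD:
  assumes "lifts sig \<pi> A M X h"
  shows "h x \<in> universe A" and "x \<in> X \<Longrightarrow> \<pi> (h x) = x"
    and "S \<in> sig \<Longrightarrow> ys \<in> interp M S \<Longrightarrow> set ys \<subseteq> X \<Longrightarrow> map h ys \<in> interp A S"
  using assms unfolding lifts_def by auto

lemma lifts_mono: "lifts sig \<pi> A M X h \<Longrightarrow> Y \<subseteq> X \<Longrightarrow> lifts sig \<pi> A M Y h"
  unfolding lifts_def by blast

lemma lifts_UnD:
  assumes "lifts sig \<pi> A M (X \<union> Y) h"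
  shows "lifts sig \<pi> A M X h" and "lifts sig \<pi> A M Y h"
  by (rule lifts_mono [OF assms], simp)+

lemma coversD:
  assumes "covers sig k \<pi> A M"
  shows "universe A \<noteq> {}" and "\<pi> ` universe A = universe M"
    and "S \<in> sig \<Longrightarrow> as \<in> interp A S \<Longrightarrow> map \<pi> as \<in> interp M S"
    and "finite X \<Longrightarrow> X \<subseteq> universe M \<Longrightarrow> card X \<le> k \<Longrightarrow> e \<in> universe A \<Longrightarrow> \<pi> e \<in> X \<Longrightarrow>
      \<exists>h. h (\<pi> e) = e \<and> lifts sig \<pi> A M X h"
  using assms unfolding covers_def by auto

lemma covers_lift:
  assumes "covers sig k \<pi> A M" "finite X" "X \<subseteq> universe M" "card X \<le> k" "k \<ge> 1"
  obtains h where "lifts sig \<pi> A M X h"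
proof (cases "X = {}")
  case False
  then obtain x where "x \<in> X" "x \<in> \<pi> ` universe A"
    using assms(3) coversD(2) [OF assms(1)] by auto
  then obtain e where "e \<in> universe A" "\<pi> e \<in> X" by auto
  from coversD(4) [OF assms(1-4) this] show thesis
    using that by blast
next
  case True
  obtain e where e: "e \<in> universe A"
    using coversD(1) [OF assms(1)] by blast
  then have "\<pi> e \<in> universe M"
    using coversD(2) [OF assms(1)] by blast
  then obtain h where "lifts sig \<pi> A M {\<pi> e} h"
    using coversD(4) [OF assms(1), of "{\<pi> e}" e] e \<open>k \<ge> 1\<close> by auto
  then show thesis
    using that lifts_mono True by blast
qed

lemma sat_comp_eq:
  assumes "fv p \<subseteq> {x}" "f x = g x"
  shows "sat M f p \<longleftrightarrow> sat M g p"
  using assms by (intro sat_cong) auto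

text \<open>The negation case needs both directions: a counterexample upstairs is projected, and one
  downstairs is lifted.\<close>

lemma UNFO_covers:
  assumes cov: "\<And>k. covers sig k \<pi> A M" and "p \<in> UNFO ar sig"
  shows "(\<forall>t. range t \<subseteq> universe A \<longrightarrow> sat A t p \<longrightarrow> sat M (\<pi> \<circ> t) p) \<and>
    (\<forall>s. range s \<subseteq> universe M \<longrightarrow> sat M s p \<longrightarrow>
      (\<exists>X. finite X \<and> X \<subseteq> universe M \<and> s ` fv p \<subseteq> X \<and>
        (\<forall>h. lifts sig \<pi> A M X h \<longrightarrow> sat A (h \<circ> s) p)))"
  (is "?F p \<and> (\<forall>s. _ \<longrightarrow> _ \<longrightarrow> ?B p s)")
  using assms(2)
proof (induction rule: UNFO.induct)
  case (1 S zs)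
  have "?F (Rel S zs)"
    using coversD(3) [OF cov 1(1)] by (metis map_map sat.simps(1))
  moreover have "?B (Rel S zs) s" if "range s \<subseteq> universe M" "sat M s (Rel S zs)" for s
  proof (intro exI conjI allI impI)
    fix h assume "lifts sig \<pi> A M (s ` set zs) h"
    from liftsD(3) [OF this, of S "map s zs"] show "sat A (h \<circ> s) (Rel S zs)"
      using that 1(1) by simp
  qed (use that in auto)
  ultimately show ?case by blast
next
  case (2 x y)
  have "?B (Eq x y) s" if "range s \<subseteq> universe M" "sat M s (Eq x y)" for s
    using that by (intro exI [of _ "{s x, s y}"]) auto
  then show ?case by simp
next
  case (3 p q)
  have "?B (And p q) s" if s: "range s \<subseteq> universe M" "sat M s (And p q)" for s
  proof -
    obtain X Y where "finite X \<and> X \<subseteq> universe M \<and> s ` fv p \<subseteq> X"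
      "finite Y \<and> Y \<subseteq> universe M \<and> s ` fv q \<subseteq> Y"
      "\<And>h. lifts sig \<pi> A M X h \<Longrightarrow> sat A (h \<circ> s) p" "\<And>h. lifts sig \<pi> A M Y h \<Longrightarrow> sat A (h \<circ> s) q"
      using 3 s by (metis sat.simps(3))
    then show ?thesis
      using lifts_UnD [of sig \<pi> A M X Y] by (intro exI [of _ "X \<union> Y"] conjI allI impI) (auto simp: comp_def)
  qed
  with 3 show ?case by simp
next
  case (4 p q)
  have "?B (Or p q) s" if s: "range s \<subseteq> universe M" "sat M s (Or p q)" for s
  proof -
    obtain X where X: "finite X" "X \<subseteq> universe M"
      "\<And>h. lifts sig \<pi> A M X h \<Longrightarrow> sat A (h \<circ> s) (Or p q)"
      using 4 s by (metis sat.simps(4))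
    then show ?thesis using s(1)
      using lifts_UnD(1) [of sig \<pi> A M X "s ` fv (Or p q)"]
      by (intro exI [of _ "X \<union> s ` fv (Or p q)"] conjI allI impI) (auto simp: comp_def)
  qed
  with 4 show ?case by auto
next
  case (5 p x)
  have "?F (Ex x p)"
  proof (intro allI impI)
    fix t :: "nat \<Rightarrow> _" assume t: "range t \<subseteq> universe A" "sat A t (Ex x p)"
    then obtain a where a: "a \<in> universe A" "sat A (t(x := a)) p" by auto
    moreover have "range (t(x := a)) \<subseteq> universe A" using a t by auto
    ultimately have "sat M (\<pi> \<circ> t(x := a)) p" using 5 by blast
    moreover have "\<pi> a \<in> universe M" using a coversD(2) [OF cov] by blast
    ultimately show "sat M (\<pi> \<circ> t) (Ex x p)"
        unfolding fun_upd_comp sat.simps by blast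
  qed
  moreover have "?B (Ex x p) s" if s: "range s \<subseteq> universe M" "sat M s (Ex x p)" for s
  proof -
    obtain a where a: "a \<in> universe M" "sat M (s(x := a)) p" using s by auto
    moreover have "range (s(x := a)) \<subseteq> universe M" using a s by auto
    ultimately have "?B p (s(x := a))" using conjunct2 [OF 5(2)] by blast
    then obtain X where X: "finite X" "X \<subseteq> universe M" "s(x := a) ` fv p \<subseteq> X"
      "\<And>h. lifts sig \<pi> A M X h \<Longrightarrow> sat A (h \<circ> s(x := a)) p"
      by meson
    have "sat A (h \<circ> s) (Ex x p)" if "lifts sig \<pi> A M X h" for h
      using X(4) [OF that] liftsD(1) [OF that] unfolding fun_upd_comp sat.simps by blast
    moreover have "s ` fv (Ex x p) \<subseteq> X" using X(3) by auto
    ultimately show ?thesis using X(1,2) by blast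
  qed
  ultimately show ?case by blast
next
  case (6 p)
  obtain x where x: "fv p \<subseteq> {x}" using fv_unary 6(2) by blast
  have "?F (Neg p)"
  proof (intro allI impI)
    fix t :: "nat \<Rightarrow> _" assume t: "range t \<subseteq> universe A" "sat A t (Neg p)"
    have r: "range (\<pi> \<circ> t) \<subseteq> universe M"
      using t(1) coversD(2) [OF cov] by auto
    show "sat M (\<pi> \<circ> t) (Neg p)"
    proof (rule ccontr)
      assume "\<not> sat M (\<pi> \<circ> t) (Neg p)"
      then obtain X where X: "finite X" "X \<subseteq> universe M"
        "\<And>h. lifts sig \<pi> A M X h \<Longrightarrow> sat A (h \<circ> (\<pi> \<circ> t)) p"
        using 6 r by (metis sat.simps(6))
      \<comment> \<open>If \<open>p\<close> is a sentence, \<open>X\<close> may miss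
        \<open>\<pi> (t x)\<close>. Once this point is inserted, the lift can be sent through
        \<open>t x\<close>, and \<open>p\<close> becomes true at the given element of
        \<open>A\<close>.\<close>
      have "finite (insert (\<pi> (t x)) X)" "insert (\<pi> (t x)) X \<subseteq> universe M"
        using X r by auto
      then obtain h where h: "h (\<pi> (t x)) = t x" "lifts sig \<pi> A M (insert (\<pi> (t x)) X) h"
        using coversD(4) [OF cov, of "insert (\<pi> (t x)) X" _ "t x"] t(1) by blast
      then have "sat A (h \<circ> (\<pi> \<circ> t)) p" using X(3) lifts_mono by blast
      then have "sat A t p" using sat_comp_eq [OF x, of "h \<circ> (\<pi> \<circ> t)" t] h by simp
      then show False using t by simp
    qed
  qed
  moreover have "?B (Neg p) s" if s: "range s \<subseteq> universe M" "sat M s (Neg p)" for s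
  proof (intro exI conjI allI impI)
    fix h assume h: "lifts sig \<pi> A M {s x} h"
    have "\<not> sat A (h \<circ> s) p"
    proof
      assume "sat A (h \<circ> s) p"
      moreover have "range (h \<circ> s) \<subseteq> universe A" using liftsD(1) [OF h] by auto
      ultimately have "sat M (\<pi> \<circ> (h \<circ> s)) p" using 6 by blast
      then have "sat M s p"
        using sat_comp_eq [OF x, of "\<pi> \<circ> (h \<circ> s)" s] liftsD(2) [OF h] by simp
      then show False using s by simp
    qed
    then show "sat A (h \<circ> s) (Neg p)" by simp
  qed (use s x in auto)
  ultimately show ?case by blast
qed

lemma is_model_covers:
  assumes "\<And>k. covers sig k \<pi> A M" "UNFO_theory ar sig T" "is_model M T"
  shows "is_model A T"
  unfolding is_model_def
proof (intro ballI allI impI)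
  fix p and s :: "nat \<Rightarrow> _" assume p: "p \<in> T" and s: "range s \<subseteq> universe A"
  then have *: "p \<in> UNFO ar sig" "fv p = {}"
    using assms(2) unfolding UNFO_theory_def by auto
  have "range (\<pi> \<circ> s) \<subseteq> universe M"
    using s coversD(2) [OF assms(1)] by auto
  moreover from this have "sat M (\<pi> \<circ> s) p"
    using assms(3) p unfolding is_model_def by blast
  ultimately obtain X where "finite X" "X \<subseteq> universe M"
    "\<And>h. lifts sig \<pi> A M X h \<Longrightarrow> sat A (h \<circ> (\<pi> \<circ> s)) p"
    using UNFO_covers [OF assms(1) *(1)] by blast
  \<comment> \<open>The size of \<open>X\<close> depends on the sentence, so coverings of every
    width are used; the successor guarantees a width of at least one.\<close>
  moreover from this obtain h where "lifts sig \<pi> A M X h"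
    using covers_lift [OF assms(1) [of "Suc (card X)"]] by (metis le_SucI order_refl le_add1 plus_1_eq_Suc)
  moreover have "sat A (h \<circ> (\<pi> \<circ> s)) p \<longleftrightarrow> sat A s p"
    by (rule sat_cong) (simp add: *(2))
  ultimately show "sat A s p" by blast
qed

text \<open>For a fixed width, the witnesses of a block of quantifiers are the values of its variables,
  so that at most \<open>k\<close> elements have to be lifted at a time.\<close>

lemma un_normal_covers:
  assumes cov: "covers sig k \<pi> A M" and k: "k \<ge> 1"
    and "p \<in> UNFO ar sig" "un_normal_at b p" "card (vars p) \<le> k"
  shows "(\<forall>t. range t \<subseteq> universe A \<longrightarrow> sat A t p \<longrightarrow> sat M (\<pi> \<circ> t) p) \<and>
    (\<forall>s. range s \<subseteq> universe M \<longrightarrow> sat M s p \<longrightarrow>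
      (if b then \<exists>s'. range s' \<subseteq> universe M \<and> (\<forall>x\<in>fv p. s' x = s x) \<and>
        (\<forall>h. lifts sig \<pi> A M (s' ` vars p) h \<longrightarrow> sat A (h \<circ> s) p)
       else \<forall>h. lifts sig \<pi> A M (s ` fv p) h \<longrightarrow> sat A (h \<circ> s) p))"
  (is "?F p \<and> (\<forall>s. _ \<longrightarrow> _ \<longrightarrow> (if b then ?B1 p s else ?B0 p s))")
  using assms(3-5)
proof (induction arbitrary: b rule: UNFO.induct)
  \<comment> \<open>\<open>?B0\<close> implies \<open>?B1\<close> with \<open>s' = s\<close>,
    because free variables are among all variables. Hence only quantifiers need separate treatment
    of the flag.\<close>
  have B0: "if b then ?B1 p s else ?B0 p s" if "range s \<subseteq> universe M" "?B0 p s" for p s b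
  proof (cases b)
    case True
    have sub: "s ` fv p \<subseteq> s ` vars p" using fv_subset_vars by blast
    have "sat A (h \<circ> s) p" if "lifts sig \<pi> A M (s ` vars p) h" for h
      using \<open>?B0 p s\<close> lifts_mono [OF that sub] by blast
    then have "?B1 p s" using \<open>range s \<subseteq> universe M\<close> by blast
    with True show ?thesis by (simp only: if_True)
  qed (use that in \<open>simp only: if_False\<close>)
  have B: "\<forall>s. range s \<subseteq> universe M \<longrightarrow> sat M s p \<longrightarrow> (if b then ?B1 p s else ?B0 p s)"
    if "\<And>s. range s \<subseteq> universe M \<Longrightarrow> sat M s p \<Longrightarrow> ?B0 p s" for p b
    using B0 that by blast
  {
    case (1 S zs)
    have "?F (Rel S zs)"
      using coversD(3) [OF cov 1(1)] by (metis map_map sat.simps(1))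
    moreover have "?B0 (Rel S zs) s" if "range s \<subseteq> universe M" "sat M s (Rel S zs)" for s
    proof (intro allI impI)
      fix h assume "lifts sig \<pi> A M (s ` fv (Rel S zs)) h"
      from liftsD(3) [OF this, of S "map s zs"] show "sat A (h \<circ> s) (Rel S zs)"
        using that 1(1) by simp
    qed
    ultimately show ?case using B [of "Rel S zs"] by blast
  next
    case (2 x y)
    have "?B0 (Eq x y) s" if "range s \<subseteq> universe M" "sat M s (Eq x y)" for s
      using that by auto
    from B [OF this] show ?case by (intro conjI) auto
  next
    case (3 p q)
    have c: "card (vars p) \<le> k" "card (vars q) \<le> k"
      using 3(6) card_mono [of "vars (And p q)"] by (metis Un_upper1 Un_upper2 dual_order.trans finite_vars vars.simps(3))+
    have "un_normal_at False p" "un_normal_at False q" using 3 by auto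
    note IH = 3(3) [OF this(1) c(1)] 3(4) [OF this(2) c(2)]
    have "?B0 (And p q) s" if s: "range s \<subseteq> universe M" "sat M s (And p q)" for s
    proof (intro allI impI)
      fix h assume h: "lifts sig \<pi> A M (s ` fv (And p q)) h"
      have "lifts sig \<pi> A M (s ` fv p) h" "lifts sig \<pi> A M (s ` fv q) h"
        by (rule lifts_mono [OF h], force)+
      then show "sat A (h \<circ> s) (And p q)" using IH s by simp
    qed
    moreover have "?F (And p q)" using IH unfolding sat.simps by blast
    ultimately show ?case using B [of "And p q"] by blast
  next
    case (4 p q)
    have c: "card (vars p) \<le> k" "card (vars q) \<le> k"
      using 4(6) card_mono [of "vars (Or p q)"] by (metis Un_upper1 Un_upper2 dual_order.trans finite_vars vars.simps(4))+
    have "un_normal_at False p" "un_normal_at False q" using 4 by auto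
    note IH = 4(3) [OF this(1) c(1)] 4(4) [OF this(2) c(2)]
    have "?B0 (Or p q) s" if s: "range s \<subseteq> universe M" "sat M s (Or p q)" for s
    proof (intro allI impI)
      fix h assume h: "lifts sig \<pi> A M (s ` fv (Or p q)) h"
      have "lifts sig \<pi> A M (s ` fv p) h" "lifts sig \<pi> A M (s ` fv q) h"
        by (rule lifts_mono [OF h], force)+
      then show "sat A (h \<circ> s) (Or p q)" using IH s by auto
    qed
    moreover have "?F (Or p q)" using IH unfolding sat.simps by blast
    ultimately show ?case using B [of "Or p q"] by blast
  next
    case (5 p x)
    have "card (vars p) \<le> k" "un_normal_at True p"
      using 5(3,4) card_mono [of "insert x (vars p)" "vars p"] subset_insertI [of "vars p" x]
      by auto
    note IH = 5(2) [OF this(2,1)]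
    have F: "?F (Ex x p)"
    proof (intro allI impI)
      fix t :: "nat \<Rightarrow> _" assume t: "range t \<subseteq> universe A" "sat A t (Ex x p)"
      then obtain a where a: "a \<in> universe A" "sat A (t(x := a)) p" by auto
      moreover have "range (t(x := a)) \<subseteq> universe A" using a t by auto
      ultimately have "sat M (\<pi> \<circ> t(x := a)) p" using IH by blast
      moreover have "\<pi> a \<in> universe M" using a coversD(2) [OF cov] by blast
      ultimately show "sat M (\<pi> \<circ> t) (Ex x p)"
        unfolding fun_upd_comp sat.simps by blast
    qed
    have B1: "?B1 (Ex x p) s" if s: "range s \<subseteq> universe M" "sat M s (Ex x p)" for s
    proof -
      obtain a where a: "a \<in> universe M" "sat M (s(x := a)) p" using s by auto
      moreover have "range (s(x := a)) \<subseteq> universe M" using a s by auto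
      ultimately have "?B1 p (s(x := a))" using conjunct2 [OF IH] unfolding if_True by blast
      \<comment> \<open>Agreement on \<open>fv p\<close> is all that can be kept: a variable
        requantified inside the block loses its earlier value. One value per variable name is
        enough, which bounds the set to be lifted by \<open>card (vars (Ex x p))\<close>.\<close>
      then obtain s' where s': "range s' \<subseteq> universe M" "\<forall>z\<in>fv p. s' z = (s(x := a)) z"
        "\<And>h. lifts sig \<pi> A M (s' ` vars p) h \<Longrightarrow> sat A (h \<circ> s(x := a)) p"
        by meson
      have "sat A (h \<circ> s) (Ex x p)" if "lifts sig \<pi> A M (s' ` vars (Ex x p)) h" for h
      proof -
        have "lifts sig \<pi> A M (s' ` vars p) h" by (rule lifts_mono [OF that]) auto
        from s'(3) [OF this] liftsD(1) [OF this] show ?thesis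
          unfolding fun_upd_comp sat.simps by blast
      qed
      moreover have "\<forall>z\<in>fv (Ex x p). s' z = s z" using s'(2) by simp
      ultimately show ?thesis using s'(1) by blast
    qed
    \<comment> \<open>The given \<open>h\<close> lifts the free values but not the witnesses. At
      most one variable \<open>y\<close> is free here, so the covering supplies a second lift
      \<open>h'\<close> of all witnesses through \<open>h (s y)\<close>, and the formula cannot
      distinguish \<open>h' \<circ> s\<close> from \<open>h \<circ> s\<close>.\<close>
    have B0': "?B0 (Ex x p) s" if b: "\<not> b" and s: "range s \<subseteq> universe M" "sat M s (Ex x p)" for s
    proof (intro allI impI)
      fix h assume h: "lifts sig \<pi> A M (s ` fv (Ex x p)) h"
      obtain s' where s': "range s' \<subseteq> universe M" "\<forall>z\<in>fv (Ex x p). s' z = s z"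
        "\<And>h. lifts sig \<pi> A M (s' ` vars (Ex x p)) h \<Longrightarrow> sat A (h \<circ> s) (Ex x p)"
        using B1 [OF s] by blast
      let ?X = "s' ` vars (Ex x p)"
      have X: "finite ?X" "?X \<subseteq> universe M" "card ?X \<le> k"
        using s'(1) 5(4) card_image_le [of "vars (Ex x p)" s'] by auto
      have "card (fv (Ex x p)) \<le> 1" using 5(3) b by simp
      then obtain y where y: "fv (Ex x p) \<subseteq> {y}" using fv_unary by blast
      show "sat A (h \<circ> s) (Ex x p)"
      proof (cases "fv (Ex x p) = {}")
        case True
        obtain h' where "lifts sig \<pi> A M ?X h'" using covers_lift [OF cov X k] .
        from s'(3) [OF this] show ?thesis
          using sat_cong [of "Ex x p" "h' \<circ> s" "h \<circ> s"] True by blast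
      next
        case False
        then have fv: "fv (Ex x p) = {y}" using y by blast
        then have "s y \<in> ?X"
          using s'(2) fv_subset_vars [of "Ex x p"] by (metis image_eqI insertI1 subsetD)
        moreover have "h (s y) \<in> universe A" "\<pi> (h (s y)) = s y"
          using liftsD(1,2) [OF h] fv by auto
        ultimately obtain h' where "h' (s y) = h (s y)" "lifts sig \<pi> A M ?X h'"
          using coversD(4) [OF cov X, of "h (s y)"] by auto
        with s'(3) [OF this(2)] show ?thesis
          using sat_comp_eq [OF y, of "h' \<circ> s" "h \<circ> s"] by simp
      qed
    qed
    have "if b then ?B1 (Ex x p) s else ?B0 (Ex x p) s"
      if "range s \<subseteq> universe M" "sat M s (Ex x p)" for s
    proof (cases b)
      case True
      then show ?thesis using B1 [OF that] by (simp only: if_True)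
    next
      case False
      then show ?thesis using B0' [OF False that] by (simp only: if_False)
    qed
    with F show ?case by blast
  next
    case (6 p)
    have "card (vars p) \<le> k" "un_normal_at False p"
      using 6(4,5) by auto
    note IH = 6(3) [OF this(2,1)]
    obtain x where x: "fv p \<subseteq> {x}" using fv_unary 6(2) by blast
    have "?F (Neg p)"
    proof (intro allI impI)
      fix t :: "nat \<Rightarrow> _" assume t: "range t \<subseteq> universe A" "sat A t (Neg p)"
      have r: "range (\<pi> \<circ> t) \<subseteq> universe M"
        using t(1) coversD(2) [OF cov] by auto
      show "sat M (\<pi> \<circ> t) (Neg p)"
      proof (rule ccontr)
        assume "\<not> sat M (\<pi> \<circ> t) (Neg p)"
        then have X: "sat A (h \<circ> (\<pi> \<circ> t)) p" if "lifts sig \<pi> A M ((\<pi> \<circ> t) ` fv p) h" for h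
          using conjunct2 [OF IH] r that unfolding if_False sat.simps not_not by blast
        have "{\<pi> (t x)} \<subseteq> universe M" "card {\<pi> (t x)} \<le> k"
          using r k by auto
        then obtain h where h: "h (\<pi> (t x)) = t x" "lifts sig \<pi> A M {\<pi> (t x)} h"
          using coversD(4) [OF cov, of "{\<pi> (t x)}" "t x"] t(1) by blast
        have "lifts sig \<pi> A M ((\<pi> \<circ> t) ` fv p) h"
          by (rule lifts_mono [OF h(2)]) (use x in auto)
        from X [OF this] have "sat A t p" using sat_comp_eq [OF x, of "h \<circ> (\<pi> \<circ> t)" t] h by simp
        then show False using t by simp
      qed
    qed
    moreover have "?B0 (Neg p) s" if s: "range s \<subseteq> universe M" "sat M s (Neg p)" for s
    proof (intro allI impI)
      fix h assume h: "lifts sig \<pi> A M (s ` fv (Neg p)) h"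
      have "\<not> sat A (h \<circ> s) p"
      proof
        assume "sat A (h \<circ> s) p"
        moreover have "range (h \<circ> s) \<subseteq> universe A" using liftsD(1) [OF h] by auto
        ultimately have "sat M (\<pi> \<circ> (h \<circ> s)) p" using IH by blast
        then have "sat M s p"
          using sat_cong [of p "\<pi> \<circ> (h \<circ> s)" s] liftsD(2) [OF h] by simp
        then show False using s by simp
      qed
      then show "sat A (h \<circ> s) (Neg p)" by simp
    qed
    ultimately show ?case using B [of "Neg p"] by blast
  }
qed

text \<open>The normal form stands in for the sentence itself: pulling quantifiers preserves truth
  in both structures, and the normal form can be lifted \<open>k\<close> elements at a time.\<close>

lemma is_model_covers_width:
  assumes cov: "covers sig k \<pi> A M" and k: "k \<ge> 1"
    and T: "UNFO_theory ar sig T" "T \<subseteq> UNFO_width ar sig k" and M: "is_model M T"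
  shows "is_model A T"
  unfolding is_model_def
proof (intro ballI allI impI)
  fix p and s :: "nat \<Rightarrow> _" assume p: "p \<in> T" and s: "range s \<subseteq> universe A"
  have ne: "universe A \<noteq> {}" "universe M \<noteq> {}"
    using coversD(1,2) [OF cov] by auto
  have r: "range (\<pi> \<circ> s) \<subseteq> universe M"
    using s coversD(2) [OF cov] by auto
  obtain q where q: "pull_step\<^sup>*\<^sup>* p q" "un_normal q" "card (vars q) \<le> k"
    using p T(2) unfolding UNFO_width_def has_width_def by auto
  have "p \<in> UNFO ar sig" "fv p = {}"
    using p T(1) unfolding UNFO_theory_def by auto
  then have q': "q \<in> UNFO ar sig" "fv q = {}"
    using pull_steps(1,2) [OF q(1)] by auto
  have "sat M (\<pi> \<circ> s) p"
    using M p r unfolding is_model_def by blast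
  then have "sat M (\<pi> \<circ> s) q"
    using pull_steps(3) [OF q(1) ne(2)] by blast
  then obtain s' where s': "range s' \<subseteq> universe M"
    "\<And>h. lifts sig \<pi> A M (s' ` vars q) h \<Longrightarrow> sat A (h \<circ> (\<pi> \<circ> s)) q"
    using un_normal_covers [OF cov k q'(1) q(2)[unfolded un_normal_def] q(3)] r
    unfolding if_True by blast
  have "finite (s' ` vars q)" "s' ` vars q \<subseteq> universe M" "card (s' ` vars q) \<le> k"
    using s'(1) q(3) card_image_le [of "vars q" s'] by auto
  then obtain h where "lifts sig \<pi> A M (s' ` vars q) h"
    using covers_lift [OF cov _ _ _ k] by blast
  moreover have "sat A (h \<circ> (\<pi> \<circ> s)) q \<longleftrightarrow> sat A s q"
    by (rule sat_cong) (simp add: q'(2))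
  ultimately have "sat A s q" using s'(2) by blast
  then show "sat A s p"
    using pull_steps(3) [OF q(1) ne(1)] by blast
qed

section \<open>Downward Loewenheim-Skolem\<close>

lemma lepoll_Times_infinite:
  assumes "infinite (UNIV :: 'u set)" "A \<lesssim> (UNIV :: 'u set)" "B \<lesssim> (UNIV :: 'u set)"
  shows "A \<times> B \<lesssim> (UNIV :: 'u set)"
proof -
  have "(UNIV :: 'u set) \<times> (UNIV :: 'u set) \<lesssim> (UNIV :: 'u set)"
    unfolding lepoll_def card_of_ordLeq
    using card_of_Times_same_infinite [OF assms(1)] by (rule ordIso_imp_ordLeq)
  then show ?thesis
    using times_lepoll_mono [OF assms(2,3)] lepoll_trans by blast
qed

lemma lists_lepoll_infinite:
  assumes inf: "infinite (UNIV :: 'u set)" and A: "A \<lesssim> (UNIV :: 'u set)"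
  shows "lists A \<lesssim> (UNIV :: 'u set)"
proof -
  let ?U = "UNIV :: 'u set"
  have nat: "(UNIV :: nat set) \<lesssim> ?U"
    using inf infinite_le_lepoll by blast
  have "?U \<times> ?U \<lesssim> ?U"
    by (rule lepoll_Times_infinite [OF inf]) simp_all
  then obtain pair :: "'u \<times> 'u \<Rightarrow> 'u" where pair: "inj pair"
    unfolding lepoll_def by auto
  \<comment> \<open>Iterated pairing. The code of the empty list is arbitrary and may clash with
    others, so the length is recorded beside it.\<close>
  define code where "code = rec_list undefined (\<lambda>x xs c. pair (x, c))"
  have code: "code (x # xs) = pair (x, code xs)" for x xs
    unfolding code_def by simp
  have "xs = ys" if "length xs = length ys" "code xs = code ys" for xs ys
    using that by (induction xs ys rule: list_induct2) (use pair in \<open>auto simp: code inj_eq\<close>)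
  then have "inj (\<lambda>xs. (length xs, code xs))"
    by (auto intro: injI)
  then have "(UNIV :: 'u list set) \<lesssim> (UNIV :: nat set) \<times> ?U"
    unfolding lepoll_def by blast
  also have "\<dots> \<lesssim> ?U"
    by (rule lepoll_Times_infinite [OF inf nat]) simp
  finally have "lists ?U \<lesssim> ?U" by simp
  then show ?thesis
    using lists_lepoll_mono [OF A] lepoll_trans by blast
qed

text \<open>Polish notation, with the number of arguments of an atom written out so that the code is
  uniquely readable.\<close>

primrec polish :: "'r fm \<Rightarrow> ('r + nat) list" where
  "polish (Rel S xs) = Inr 0 # Inl S # Inr (length xs) # map Inr xs"
| "polish (Eq x y) = [Inr 1, Inr x, Inr y]"
| "polish (And p q) = Inr 2 # polish p @ polish q"
| "polish (Or p q) = Inr 3 # polish p @ polish q"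
| "polish (Ex x p) = Inr 4 # Inr x # polish p"
| "polish (Neg p) = Inr 5 # polish p"

text \<open>The suffixes carry the induction: for binary connectives two codes are concatenated, and
  the end of the first must be recovered before the second can be read.\<close>

lemma polish_append_eq: "polish p @ u = polish q @ v \<Longrightarrow> p = q \<and> u = v"
proof (induction p arbitrary: q u v)
  case (Rel S xs)
  then show ?case
    by (cases q) (auto simp: append_eq_append_conv inj_map_eq_map)
next
  case (And p1 p2)
  from And(3) show ?case by (cases q) (auto dest!: And.IH)
next
  case (Or p1 p2)
  from Or(3) show ?case by (cases q) (auto dest!: Or.IH)
next
  case (Eq x y)
  then show ?case by (cases q) auto
next
  case (Ex x p)
  from Ex(2) show ?case by (cases q) (auto dest!: Ex.IH)
next
  case (Neg p)
  from Neg(2) show ?case by (cases q) (auto dest!: Neg.IH)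
qed

text \<open>Formulas are counted over \<open>sig\<close>, since the type \<open>'r\<close> itself
  may exceed \<open>'u\<close>.\<close>

lemma UNFO_lepoll:
  assumes inf: "infinite (UNIV :: 'u set)" and sig: "sig \<lesssim> (UNIV :: 'u set)"
  shows "UNFO ar sig \<lesssim> (UNIV :: 'u set)"
proof -
  have "set (polish p) \<subseteq> sig <+> UNIV" if "p \<in> UNFO ar sig" for p
    using that by induction auto
  then have "polish ` UNFO ar sig \<subseteq> lists (sig <+> UNIV)" by auto
  moreover have "inj polish"
    using polish_append_eq [of _ "[]" _ "[]"] by (auto intro: injI)
  ultimately have "UNFO ar sig \<lesssim> lists (sig <+> (UNIV :: nat set))"
    unfolding lepoll_def using inj_on_subset by blast
  also have "\<dots> \<lesssim> (UNIV :: 'u set)"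
  proof (rule lists_lepoll_infinite [OF inf])
    have nat: "(UNIV :: nat set) \<lesssim> (UNIV :: 'u set)"
      using inf infinite_le_lepoll by blast
    then have bool: "(UNIV :: bool set) \<lesssim> (UNIV :: 'u set)"
      by (intro finite_lepoll_infinite inf) simp
    have "sig <+> (UNIV :: nat set) \<lesssim> (UNIV :: 'u set) <+> (UNIV :: 'u set)"
      by (rule sum_lepoll_mono [OF sig nat])
    also have "\<dots> \<lesssim> (UNIV :: bool set) \<times> (UNIV :: 'u set)"
      unfolding lepoll_def
      by (intro exI [of _ "case_sum (Pair True) (Pair False)"]) (auto simp: inj_on_def split: sum.splits)
    also have "\<dots> \<lesssim> (UNIV :: 'u set)"
      by (rule lepoll_Times_infinite [OF inf bool]) simp
    finally show "sig <+> (UNIV :: nat set) \<lesssim> (UNIV :: 'u set)" .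
  qed
  finally show ?thesis .
qed

section \<open>Substructures, isomorphic copies and elementary subsets\<close>

definition restrict_struc :: "'a set \<Rightarrow> ('a, 'r) struc \<Rightarrow> ('a, 'r) struc" where
  "restrict_struc X M = Struc X (\<lambda>S. interp M S \<inter> lists X)"

definition map_struc :: "('a \<Rightarrow> 'b) \<Rightarrow> ('a, 'r) struc \<Rightarrow> ('b, 'r) struc" where
  "map_struc f M = Struc (f ` universe M) (\<lambda>S. map f ` interp M S)"

lemma struc_simps [simp]:
  "universe (restrict_struc X M) = X" "interp (restrict_struc X M) S = interp M S \<inter> lists X"
  "universe (map_struc f M) = f ` universe M" "interp (map_struc f M) S = map f ` interp M S"
  unfolding restrict_struc_def map_struc_def by simp_all

lemma sat_map_struc:
  assumes "inj_on f (universe M)" "p \<in> UNFO ar sig" "is_structure ar sig M"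
    "range s \<subseteq> universe M"
  shows "sat (map_struc f M) (f \<circ> s) p \<longleftrightarrow> sat M s p"
  using assms(2,4)
proof (induction arbitrary: s rule: UNFO.induct)
  case (1 S xs)
  have "interp M S \<subseteq> lists (universe M)"
    using assms(3) 1(1) unfolding is_structure_def by auto
  moreover have "map s xs \<in> lists (universe M)" using 1(3) by (auto simp: image_subset_iff)
  moreover have "inj_on (map f) (lists (universe M))"
    using assms(1) by (rule inj_on_map_lists)
  ultimately have "map f (map s xs) \<in> map f ` interp M S \<longleftrightarrow> map s xs \<in> interp M S"
    by (metis inj_on_image_mem_iff)
  then show ?case by (simp add: comp_def)
next
  case (2 x y)
  then have "s x \<in> universe M" "s y \<in> universe M" by auto
  then show ?case using inj_onD [OF assms(1)] by auto
next
  case (5 p x)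
  have "sat (map_struc f M) ((f \<circ> s)(x := f a)) p \<longleftrightarrow> sat M (s(x := a)) p"
    if "a \<in> universe M" for a
  proof -
    have "range (s(x := a)) \<subseteq> universe M" using 5(3) that by auto
    from 5(2) [OF this] show ?thesis by (simp only: fun_upd_comp)
  qed
  then show ?case unfolding sat.simps struc_simps by blast
qed auto

lemma is_model_map_struc:
  assumes "inj_on f (universe M)" "UNFO_theory ar sig T" "is_structure ar sig M" "is_model M T"
  shows "is_model (map_struc f M) T"
  unfolding is_model_def
proof (intro ballI allI impI)
  fix p and s :: "nat \<Rightarrow> _" assume p: "p \<in> T" "range s \<subseteq> universe (map_struc f M)"
  then obtain t where t: "range t \<subseteq> universe M" "s = f \<circ> t"
    by (metis (no_types, lifting) ext image_subset_iff inv_into_into f_inv_into_f comp_apply rangeI struc_simps(3) image_subsetI)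
  have "p \<in> UNFO ar sig" using assms(2) p unfolding UNFO_theory_def by auto
  then show "sat (map_struc f M) s p"
    using sat_map_struc [OF assms(1) _ assms(3) t(1)] assms(4) p t unfolding is_model_def by blast
qed

lemma is_structure_map_struc:
  "is_structure ar sig M \<Longrightarrow> is_structure ar sig (map_struc f M)"
  unfolding is_structure_def by fastforce

lemma is_structure_restrict:
  "is_structure ar sig M \<Longrightarrow> X \<noteq> {} \<Longrightarrow> is_structure ar sig (restrict_struc X M)"
  unfolding is_structure_def by auto

text \<open>A single subset must serve all of \<open>Ms\<close>, because two models are later
  compared on the same universe. It is closed under witnesses for every structure of the finite set
  \<open>Ms\<close> at once.\<close>

lemma loewenheim_skolem:
  fixes V X0 :: "'a set" and Ms :: "('a, 'r) struc set"
  assumes inf: "infinite (UNIV :: 'u set)" and sig: "sig \<lesssim> (UNIV :: 'u set)"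
    and Ms: "finite Ms" "\<And>M. M \<in> Ms \<Longrightarrow> universe M = V"
    and X0: "finite X0" "X0 \<subseteq> V" "X0 \<noteq> {}"
  obtains X where "X0 \<subseteq> X" "X \<subseteq> V" "X \<lesssim> (UNIV :: 'u set)"
    and "\<And>M p s. M \<in> Ms \<Longrightarrow> p \<in> UNFO ar sig \<Longrightarrow> range s \<subseteq> X \<Longrightarrow>
      sat (restrict_struc X M) s p \<longleftrightarrow> sat M s p"
proof -
  let ?U = "UNIV :: 'u set"
  obtain v where v: "v \<in> V" using X0 by blast
  \<comment> \<open>Assignments are stored as finite lists of values, with \<open>v\<close> beyond
    the end. Full assignments on infinitely many variables could be too numerous for the cardinality
    bound.\<close>
  define lookup :: "'a list \<Rightarrow> nat \<Rightarrow> 'a" where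
    "lookup as = (\<lambda>n. if n < length as then as ! n else v)" for as
  define wit :: "('a, 'r) struc \<times> (nat \<times> 'r fm) \<times> 'a list \<Rightarrow> 'a" where
    "wit = (\<lambda>(M, (x, p), as). if \<exists>a\<in>V. sat M ((lookup as)(x := a)) p
      then SOME a. a \<in> V \<and> sat M ((lookup as)(x := a)) p else v)"
  have wit_V: "wit k \<in> V" for k
  proof -
    obtain M x p as where k: "k = (M, (x, p), as)" by (cases k) auto
    show ?thesis
    proof (cases "\<exists>a\<in>V. sat M ((lookup as)(x := a)) p")
      case True
      then have "\<exists>a. a \<in> V \<and> sat M ((lookup as)(x := a)) p" by blast
      from someI_ex [OF this] True show ?thesis unfolding k wit_def by simp
    qed (use v in \<open>simp add: k wit_def\<close>)
  qed
  have wit_sat: "sat M ((lookup as)(x := wit (M, (x, p), as))) p"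
    if "a \<in> V" "sat M ((lookup as)(x := a)) p" for M x p as a
  proof -
    have "\<exists>a. a \<in> V \<and> sat M ((lookup as)(x := a)) p" using that by blast
    from someI_ex [OF this] that show ?thesis unfolding wit_def by auto
  qed
  define keys :: "'a set \<Rightarrow> (('a, 'r) struc \<times> (nat \<times> 'r fm) \<times> 'a list) set" where
    "keys X = Ms \<times> (UNIV \<times> UNFO ar sig) \<times> lists X" for X
  define stage where "stage n = ((\<lambda>X. X \<union> wit ` keys X) ^^ n) X0" for n
  define X where "X = (\<Union>n. stage n)"
  have stage_Suc: "stage (Suc n) = stage n \<union> wit ` keys (stage n)" for n
    unfolding stage_def by simp
  have stage_0: "stage 0 = X0"
    unfolding stage_def by simp
  have nat: "(UNIV :: nat set) \<lesssim> ?U"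
    using inf infinite_le_lepoll by blast
  have small: "stage n \<lesssim> ?U" for n
  proof (induction n)
    case 0
    show ?case unfolding stage_def using finite_lepoll_infinite [OF inf X0(1)] by simp
  next
    case (Suc n)
    have "Ms \<lesssim> ?U" using finite_lepoll_infinite [OF inf Ms(1)] .
    then have "keys (stage n) \<lesssim> ?U"
      unfolding keys_def
      by (intro lepoll_Times_infinite inf lists_lepoll_infinite Suc UNFO_lepoll sig nat)
    then have w: "wit ` keys (stage n) \<lesssim> ?U"
      using image_lepoll lepoll_trans by blast
    obtain f :: "'a \<Rightarrow> 'u" where f: "inj_on f (stage n)" using Suc unfolding lepoll_def by auto
    obtain g :: "'a \<Rightarrow> 'u" where g: "inj_on g (wit ` keys (stage n))" using w unfolding lepoll_def by auto
    have "stage (Suc n) \<lesssim> (UNIV :: nat set) \<times> ?U"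
      unfolding lepoll_def stage_Suc using f g
      by (intro exI [of _ "\<lambda>a. if a \<in> stage n then (0, f a) else (1, g a)"])
        (auto simp: inj_on_def)
    also have "\<dots> \<lesssim> ?U" by (rule lepoll_Times_infinite [OF inf nat]) simp
    finally show ?case .
  qed
  have "X \<lesssim> ?U"
  proof -
    \<comment> \<open>The embeddings of the stages are unrelated, so an element is coded by its
      first stage together with its image there.\<close>
    define lev where "lev a = (LEAST n. a \<in> stage n)" for a
    have lev: "a \<in> stage (lev a)" if "a \<in> X" for a
      using that unfolding X_def lev_def by (auto intro: LeastI)
    obtain f :: "nat \<Rightarrow> 'a \<Rightarrow> 'u" where f: "\<And>n. inj_on (f n) (stage n)" "\<And>n. f n ` stage n \<subseteq> ?U"
      using small unfolding lepoll_def by meson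
    have "inj_on (\<lambda>a. (lev a, f (lev a) a)) X"
      using lev f(1) unfolding inj_on_def by (metis prod.inject)
    then have "X \<lesssim> (UNIV :: nat set) \<times> ?U" unfolding lepoll_def by blast
    also have "\<dots> \<lesssim> ?U" by (rule lepoll_Times_infinite [OF inf nat]) simp
    finally show ?thesis .
  qed
  have "stage n \<subseteq> V" for n
    by (induction n) (use X0(2) wit_V in \<open>auto simp: stage_0 stage_Suc\<close>)
  then have XV: "X \<subseteq> V" unfolding X_def by blast
  have X0X: "X0 \<subseteq> X" unfolding X_def using stage_0 by blast
  have mono: "stage m \<subseteq> stage n" if "m \<le> n" for m n
    using that by (induction n rule: dec_induct) (auto simp: stage_Suc)
  have closed: "wit (M, (x, p), as) \<in> X"
    if "M \<in> Ms" "p \<in> UNFO ar sig" "set as \<subseteq> X" for M x p as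
  proof -
    have "\<exists>n. set as \<subseteq> stage n" using that(3)
    proof (induction as)
      case (Cons a as)
      then obtain m n where "set as \<subseteq> stage m" "a \<in> stage n" unfolding X_def by auto
      then have "set (a # as) \<subseteq> stage (max m n)"
        using mono [of m "max m n"] mono [of n "max m n"] by auto
      then show ?case by blast
    qed simp
    then obtain n where "set as \<subseteq> stage n" by blast
    then have "wit (M, (x, p), as) \<in> stage (Suc n)"
      unfolding stage_Suc keys_def using that by blast
    then show ?thesis unfolding X_def by blast
  qed
  have "sat (restrict_struc X M) s p \<longleftrightarrow> sat M s p"
    if M: "M \<in> Ms" and "p \<in> UNFO ar sig" "range s \<subseteq> X" for M p s
    using that(2,3)
  proof (induction arbitrary: s rule: UNFO.induct)
    case (1 S xs)
    then have "map s xs \<in> lists X" by (auto simp: image_subset_iff)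
    then show ?case by simp
  next
    case (5 p x)
    have IH: "sat (restrict_struc X M) (s(x := a)) p \<longleftrightarrow> sat M (s(x := a)) p" if "a \<in> X" for a
    proof -
      have "range (s(x := a)) \<subseteq> X" using 5(3) that by auto
      then show ?thesis by (rule 5(2))
    qed
    have "\<exists>b\<in>X. sat M (s(x := b)) p" if "a \<in> V" "sat M (s(x := a)) p" for a
    proof -
      \<comment> \<open>The list reaches the largest variable of \<open>p\<close>; adding
        \<open>0\<close> keeps \<open>Max\<close> away from the empty set.\<close>
      define as where "as = map s [0..<Suc (Max (vars p \<union> {0}))]"
      have lu: "lookup as z = s z" if "z \<in> fv p" for z
      proof -
        have "z \<le> Max (vars p \<union> {0})" using that fv_subset_vars [of p] by (intro Max_ge) auto
        then have "z < length as" "as ! z = s z"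
          unfolding as_def by (simp_all add: less_Suc_eq_le nth_append del: upt_Suc)
        then show ?thesis unfolding lookup_def by simp
      qed
      have eq: "sat M ((lookup as)(x := b)) p \<longleftrightarrow> sat M (s(x := b)) p" for b
        using lu by (intro sat_cong) auto
      have "set as \<subseteq> X" using 5(3) unfolding as_def by auto
      then have "wit (M, (x, p), as) \<in> X" by (rule closed [OF M 5(1)])
      moreover have "sat M (s(x := wit (M, (x, p), as))) p"
        using wit_sat [OF that(1), where M = M and as = as and x = x and p = p] that(2) unfolding eq by blast
      ultimately show ?thesis by blast
    qed
    then show ?case using IH XV Ms(2) [OF M] by auto
  qed auto
  with X0X XV \<open>X \<lesssim> ?U\<close> show thesis using that by blast
qed

text \<open>Implicit definability is assumed over \<open>'u\<close> only, while the models built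
  below live on other types. A difference at one tuple survives in a common elementary subset
  containing that tuple, and an injection carries this subset into \<open>'u\<close>.\<close>

lemma implicitly_defines_any:
  fixes M1 M2 :: "('a, 'r) struc"
  assumes inf: "infinite (UNIV :: 'u set)" and sig: "sig \<lesssim> (UNIV :: 'u set)"
    and T: "UNFO_theory ar sig T" and R: "R \<in> sig" and tau: "tau \<subseteq> sig"
    and impl: "implicitly_defines TYPE('u) ar sig T R tau"
    and univ: "universe M1 = universe M2"
    and str: "is_structure ar sig M1" "is_structure ar sig M2"
    and mod: "is_model M1 T" "is_model M2 T"
    and eq: "\<And>S. S \<in> tau \<Longrightarrow> interp M1 S = interp M2 S"
  shows "interp M1 R = interp M2 R"
proof -
  have "as \<in> interp M1 R \<longleftrightarrow> as \<in> interp M2 R" if as: "set as \<subseteq> universe M1" for as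
  proof -
    \<comment> \<open>Keeps the starting set nonempty when \<open>as\<close> is the empty
      tuple.\<close>
    obtain v where v: "v \<in> universe M1" using str(1) unfolding is_structure_def by blast
    obtain X where X: "insert v (set as) \<subseteq> X" "X \<subseteq> universe M1" "X \<lesssim> (UNIV :: 'u set)"
      "\<And>M p s. M \<in> {M1, M2} \<Longrightarrow> p \<in> UNFO ar sig \<Longrightarrow> range s \<subseteq> X \<Longrightarrow>
        sat (restrict_struc X M) s p \<longleftrightarrow> sat M s p"
      by (rule loewenheim_skolem [OF inf sig, of "{M1, M2}" "universe M1" "insert v (set as)" ar])
        (use univ as v in auto)
    obtain f :: "'a \<Rightarrow> 'u" where f: "inj_on f X" using X(3) unfolding lepoll_def by auto
    have ne: "X \<noteq> {}" using X(1) by blast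
    define N where "N M = map_struc f (restrict_struc X M)" for M :: "('a, 'r) struc"
    have N: "is_structure ar sig (N M)" "is_model (N M) T" "universe (N M) = f ` X"
      if M: "M \<in> {M1, M2}" for M
    proof -
      have s: "is_structure ar sig (restrict_struc X M)"
        using M str ne is_structure_restrict by blast
      then show "is_structure ar sig (N M)"
        unfolding N_def by (rule is_structure_map_struc)
      have "is_model (restrict_struc X M) T"
        unfolding is_model_def
      proof (intro ballI allI impI)
        fix p and s :: "nat \<Rightarrow> _" assume p: "p \<in> T" "range s \<subseteq> universe (restrict_struc X M)"
        then have "range s \<subseteq> universe M" using X(2) M univ by auto
        then have "sat M s p" using p M mod unfolding is_model_def by blast
        moreover have "p \<in> UNFO ar sig" using T p unfolding UNFO_theory_def by auto
        ultimately show "sat (restrict_struc X M) s p" using X(4) [OF M] p by simp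
      qed
      then show "is_model (N M) T"
        unfolding N_def using f T s by (intro is_model_map_struc) auto
      show "universe (N M) = f ` X" unfolding N_def by simp
    qed
    have "\<forall>S\<in>tau. interp (N M2) S = interp (N M1) S"
      using eq unfolding N_def by simp
    moreover have "is_structure ar tau (N M1)"
      using N(1) [of M1] tau unfolding is_structure_def by blast
    ultimately have "interp (N M1) R = interp (N M2) R"
      using impl N unfolding implicitly_defines_def is_expansion_def
      by (metis insertCI)
    moreover have "map f as \<in> interp (N M) R \<longleftrightarrow> as \<in> interp M R" for M
    proof -
      have "as \<in> lists X" using X(1) by auto
      then show ?thesis
        unfolding N_def using inj_on_image_mem_iff [OF inj_on_map_lists [OF f], of as "interp M R \<inter> lists X"]
        by simp
    qed
    ultimately show ?thesis by blast
  qed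
  moreover have "interp M1 R \<subseteq> {as. set as \<subseteq> universe M1}" "interp M2 R \<subseteq> {as. set as \<subseteq> universe M1}"
    using bspec [OF conjunct2 [OF str(1) [unfolded is_structure_def]] R]
      bspec [OF conjunct2 [OF str(2) [unfolded is_structure_def]] R] univ by auto
  ultimately show ?thesis by blast
qed

section \<open>Ultraproducts and test formulas\<close>

lemma ex_ultrafilter:
  fixes F :: "'i filter"
  assumes "F \<noteq> bot"
  obtains U where "U \<le> F" "U \<noteq> bot"
    and "\<And>P. eventually P U \<or> eventually (\<lambda>x. \<not> P x) U"
proof -
  let ?A = "{G. G \<noteq> bot \<and> G \<le> F}"
  have "\<exists>U\<in>?A. \<forall>G\<in>?A. G \<le> U \<longrightarrow> G = U"
  proof (rule predicate_Zorn)
    show "partial_order_on ?A (relation_of (\<lambda>G H. H \<le> G) ?A)"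
      by (rule partial_order_on_relation_ofI) auto
  next
    fix C assume C: "C \<in> Chains (relation_of (\<lambda>G H. H \<le> G) ?A)"
    show "\<exists>U\<in>?A. \<forall>G\<in>C. U \<le> G"
    proof (cases "C = {}")
      case False
      have sub: "C \<subseteq> ?A" and lin: "\<And>G H. G \<in> C \<Longrightarrow> H \<in> C \<Longrightarrow> G \<le> H \<or> H \<le> G"
        using C unfolding Chains_def relation_of_def by auto
      have "\<not> eventually (\<lambda>_. False) (Inf C)"
      proof (subst eventually_Inf_base)
        show "\<exists>K\<in>C. K \<le> inf G H" if "G \<in> C" "H \<in> C" for G H
          using lin [OF that] that by auto
      qed (use False sub in \<open>auto simp: trivial_limit_def\<close>)
      then have "Inf C \<noteq> bot" by auto
      moreover have "Inf C \<le> F"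
        using False sub by (metis (mono_tags, lifting) Inf_lower2 all_not_in_conv mem_Collect_eq subsetD)
      ultimately show ?thesis by (auto intro: Inf_lower)
    qed (use assms in auto)
  qed
  then obtain U where U: "U \<noteq> bot" "U \<le> F"
    and max: "\<And>G. G \<noteq> bot \<Longrightarrow> G \<le> U \<Longrightarrow> G = U"
    by (metis (mono_tags, lifting) mem_Collect_eq order_trans)
  \<comment> \<open>Zorn's lemma gave a minimal proper filter. Refining it by \<open>P\<close>
    leaves it proper, so minimality puts \<open>P\<close> into it.\<close>
  have "eventually P U" if "\<not> eventually (\<lambda>x. \<not> P x) U" for P
  proof -
    have "inf U (principal {x. P x}) \<noteq> bot"
      using that by (simp add: trivial_limit_def eventually_inf_principal)
    then have "inf U (principal {x. P x}) = U" by (rule max) simp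
    then have "U \<le> principal {x. P x}" by (metis inf.cobounded2)
    then show ?thesis by (simp add: le_principal)
  qed
  then show thesis using U that by blast
qed

section \<open>Ultraproducts on chosen representatives\<close>

locale ultraproduct =
  fixes U :: "'i filter" and Ms :: "'i \<Rightarrow> ('u, 'r) struc"
    and ar :: "'r \<Rightarrow> nat" and sig :: "'r set"
  assumes nontriv: "U \<noteq> bot"
    and ultra: "eventually P U \<or> eventually (\<lambda>i. \<not> P i) U"
    and str: "is_structure ar sig (Ms i)"
begin

definition choices :: "('i \<Rightarrow> 'u) set" where
  "choices = {f. \<forall>i. f i \<in> universe (Ms i)}"

text \<open>Replaces a quotient by one representative per class. Elements of the ultraproduct thus
  keep coordinates, and agreement at an index can be stated for them directly.\<close>

definition rep :: "('i \<Rightarrow> 'u) \<Rightarrow> 'i \<Rightarrow> 'u" where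
  "rep f = (SOME g. g \<in> choices \<and> eventually (\<lambda>i. g i = f i) U)"

definition uprod :: "('i \<Rightarrow> 'u, 'r) struc" where
  "uprod = Struc (rep ` choices) (\<lambda>S. {fs. set fs \<subseteq> rep ` choices \<and>
     eventually (\<lambda>i. map (\<lambda>f. f i) fs \<in> interp (Ms i) S) U})"

lemma rep:
  assumes "f \<in> choices"
  shows "rep f \<in> choices" and "eventually (\<lambda>i. rep f i = f i) U"
proof -
  have "f \<in> choices \<and> eventually (\<lambda>i. f i = f i) U" using assms by simp
  from someI [of "\<lambda>g. g \<in> choices \<and> eventually (\<lambda>i. g i = f i) U", OF this]
  show "rep f \<in> choices" and "eventually (\<lambda>i. rep f i = f i) U"
    unfolding rep_def by auto
qed

lemma rep_cong:
  assumes "eventually (\<lambda>i. f i = g i) U"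
  shows "rep f = rep g"
proof -
  have "eventually (\<lambda>i. h i = f i) U \<longleftrightarrow> eventually (\<lambda>i. h i = g i) U" for h
    using assms by (auto elim: eventually_elim2)
  then show ?thesis unfolding rep_def by simp
qed

lemma uprod_eqI:
  assumes "f \<in> rep ` choices" "g \<in> rep ` choices" "eventually (\<lambda>i. f i = g i) U"
  shows "f = g"
proof -
  obtain f' g' where f': "f' \<in> choices" "f = rep f'" and g': "g' \<in> choices" "g = rep g'"
    using assms by blast
  have "eventually (\<lambda>i. f' i = g' i) U"
    using rep(2) [OF f'(1)] rep(2) [OF g'(1)] assms(3)
    by eventually_elim (simp add: f'(2) g'(2))
  then show ?thesis using rep_cong f' g' by blast
qed

lemma uprod_choices: "f \<in> rep ` choices \<Longrightarrow> f i \<in> universe (Ms i)"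
  using rep(1) unfolding choices_def by blast

lemma uprod_simps [simp]:
  "universe uprod = rep ` choices"
  "interp uprod S = {fs. set fs \<subseteq> rep ` choices \<and>
     eventually (\<lambda>i. map (\<lambda>f. f i) fs \<in> interp (Ms i) S) U}"
  unfolding uprod_def by simp_all

lemma eventually_Not: "eventually (\<lambda>i. \<not> P i) U \<longleftrightarrow> \<not> eventually P U"
proof
  assume *: "eventually (\<lambda>i. \<not> P i) U"
  show "\<not> eventually P U"
  proof
    assume "eventually P U"
    from eventually_conj [OF this *] show False
      using nontriv by (simp add: trivial_limit_def)
  qed
qed (use ultra [of P] in blast)

text \<open>Los's theorem. For a quantifier, witnesses are chosen at every index and then replaced
  by their representative, which changes them on a negligible set only.\<close>

lemma sat_uprod:
  assumes "range s \<subseteq> universe uprod"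
  shows "sat uprod s p \<longleftrightarrow> eventually (\<lambda>i. sat (Ms i) (\<lambda>x. s x i) p) U"
  using assms
proof (induction p arbitrary: s)
  case (Rel S xs)
  then have "set (map s xs) \<subseteq> rep ` choices" by auto
  then show ?case by (simp add: comp_def)
next
  case (Eq x y)
  then have "s x \<in> rep ` choices" "s y \<in> rep ` choices" by auto
  from uprod_eqI [OF this] show ?case by auto
next
  case (And p q)
  then show ?case by (simp add: eventually_conj_iff)
next
  case (Or p q)
  have "eventually (\<lambda>i. P i \<or> Q i) U \<longleftrightarrow> eventually P U \<or> eventually Q U" for P Q
    using eventually_Not [of "\<lambda>i. P i \<or> Q i"] eventually_Not [of P] eventually_Not [of Q]
    by (simp add: eventually_conj_iff) blast
  with Or show ?case by simp
next
  case (Ex x p)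
  have upd: "(\<lambda>z. (s(x := f)) z i) = (\<lambda>z. s z i)(x := f i)" for f i by auto
  have IH: "sat uprod (s(x := f)) p \<longleftrightarrow>
      eventually (\<lambda>i. sat (Ms i) ((\<lambda>z. s z i)(x := f i)) p) U" if "f \<in> rep ` choices" for f
  proof -
    have "range (s(x := f)) \<subseteq> universe uprod" using Ex.prems that by auto
    from Ex.IH [OF this] show ?thesis unfolding upd .
  qed
  show ?case
  proof
    assume "sat uprod s (Ex x p)"
    then obtain f where f: "f \<in> rep ` choices"
      "eventually (\<lambda>i. sat (Ms i) ((\<lambda>z. s z i)(x := f i)) p) U"
      using IH by auto
    from f(2) show "eventually (\<lambda>i. sat (Ms i) (\<lambda>z. s z i) (Ex x p)) U"
      by eventually_elim (use uprod_choices [OF f(1)] in auto)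
  next
    assume ev: "eventually (\<lambda>i. sat (Ms i) (\<lambda>z. s z i) (Ex x p)) U"
    have "\<exists>a. a \<in> universe (Ms i) \<and> (sat (Ms i) (\<lambda>z. s z i) (Ex x p) \<longrightarrow>
        sat (Ms i) ((\<lambda>z. s z i)(x := a)) p)" for i
      using str [of i] unfolding is_structure_def sat.simps by blast
    then obtain f where f: "\<And>i. f i \<in> universe (Ms i)"
      "\<And>i. sat (Ms i) (\<lambda>z. s z i) (Ex x p) \<Longrightarrow> sat (Ms i) ((\<lambda>z. s z i)(x := f i)) p"
      by metis
    then have fc: "f \<in> choices" unfolding choices_def by simp
    have "eventually (\<lambda>i. sat (Ms i) ((\<lambda>z. s z i)(x := rep f i)) p) U"
      using ev rep(2) [OF fc] by eventually_elim (use f(2) in simp)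
    then show "sat uprod s (Ex x p)" using IH [of "rep f"] fc by auto
  qed
next
  case (Neg p)
  from Neg.IH [OF Neg.prems] show ?case by (simp only: sat.simps eventually_Not)
qed

lemma choices_nonempty: "choices \<noteq> {}"
proof -
  have "\<exists>a. a \<in> universe (Ms i)" for i
    using str [of i] unfolding is_structure_def by blast
  then obtain f where "\<And>i. f i \<in> universe (Ms i)" by metis
  then show ?thesis unfolding choices_def by blast
qed

lemma is_structure_uprod: "is_structure ar sig uprod"
  unfolding is_structure_def
proof (intro conjI ballI subsetI CollectI)
  fix S fs assume "S \<in> sig" and fs: "fs \<in> interp uprod S"
  have "eventually (\<lambda>i. length fs = ar S) U"
  proof -
    have "eventually (\<lambda>i. map (\<lambda>f. f i) fs \<in> interp (Ms i) S) U" using fs by simp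
    then show ?thesis
    proof eventually_elim
      case (elim i)
      then have "length (map (\<lambda>f. f i) fs) = ar S"
        using str [of i] \<open>S \<in> sig\<close> unfolding is_structure_def by blast
      then show ?case by simp
    qed
  qed
  then show "length fs = ar S" using nontriv eventually_const by blast
qed (use choices_nonempty in auto)

lemma is_model_uprod:
  assumes "\<And>i. is_model (Ms i) T"
  shows "is_model uprod T"
  unfolding is_model_def
proof (intro ballI allI impI)
  fix p and s :: "nat \<Rightarrow> _" assume p: "p \<in> T" "range s \<subseteq> universe uprod"
  have "sat (Ms i) (\<lambda>x. s x i) p" for i
  proof -
    have "s x i \<in> universe (Ms i)" for x
      using p(2) uprod_choices by (metis rangeI subsetD uprod_simps(1))
    then have "range (\<lambda>x. s x i) \<subseteq> universe (Ms i)" by blast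
    then show ?thesis using assms p(1) unfolding is_model_def by blast
  qed
  then show "sat uprod s p" using sat_uprod [OF p(2)] by simp
qed

end

text \<open>Only formulas in one free variable are negated; atoms are asserted but never denied.
  There are no inequalities, so distinct elements may be given the same image. Renaming by a
  transposition moves bound variables as well, which avoids capture and stays within the variables
  below \<open>k\<close>.\<close>

definition lits :: "('r \<Rightarrow> nat) \<Rightarrow> 'r set \<Rightarrow> nat \<Rightarrow> 'r fm set \<Rightarrow> 'r fm set" where
  "lits ar F k G = {Rel S zs | S zs. S \<in> F \<and> length zs = ar S \<and> set zs \<subseteq> {..<k}} \<union>
     (\<Union>g\<in>G. \<Union>i<k. {ren (transpose 0 i) g, Neg (ren (transpose 0 i) g)})"

text \<open>Test formulas of depth \<open>j\<close> in the free variable \<open>0\<close>: they describe the element \<open>0\<close> inside a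
  tuple of \<open>k\<close> elements, or, when \<open>0\<close> is quantified as well, assert that such a tuple exists
  anywhere.\<close>

primrec tests :: "('r \<Rightarrow> nat) \<Rightarrow> 'r set \<Rightarrow> nat \<Rightarrow> nat \<Rightarrow> 'r fm set" where
  "tests ar F k 0 = {}"
| "tests ar F k (Suc j) =
     (\<Union>L\<in>Pow (lits ar F k (tests ar F k j)). {exs [1..<k] (Conj L), exs [0..<k] (Conj L)})"

definition agree ::
  "('r \<Rightarrow> nat) \<Rightarrow> 'r set \<Rightarrow> nat \<Rightarrow> nat \<Rightarrow> ('a, 'r) struc \<Rightarrow> 'a \<Rightarrow> ('b, 'r) struc \<Rightarrow> 'b \<Rightarrow> bool" where
  "agree ar F k j M c N d \<longleftrightarrow>
     (\<forall>g\<in>tests ar F k j. sat M (\<lambda>_. c) g \<longleftrightarrow> sat N (\<lambda>_. d) g)"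

lemma agree_commute: "agree ar F k j M c N d \<longleftrightarrow> agree ar F k j N d M c"
  unfolding agree_def by blast

lemma inj_transpose: "inj (transpose i j)"
  by (rule inj_on_inverseI [of _ "transpose i j"]) simp

lemma finite_lits:
  assumes "finite F" "finite G"
  shows "finite (lits ar F k G)"
proof -
  have "{Rel S zs | S zs. S \<in> F \<and> length zs = ar S \<and> set zs \<subseteq> {..<k}} \<subseteq>
      (\<Union>S\<in>F. Rel S ` {zs. set zs \<subseteq> {..<k} \<and> length zs = ar S})" by auto
  moreover have "finite \<dots>"
    using assms(1) by (simp add: finite_lists_length_eq)
  ultimately show ?thesis
    unfolding lits_def using assms(2) finite_subset by fastforce
qed

lemma finite_tests: "finite F \<Longrightarrow> finite (tests ar F k j)"
  by (induction j) (auto simp: finite_lits)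

lemma transpose_image_subset: "i < k \<Longrightarrow> X \<subseteq> {..<k} \<Longrightarrow> transpose 0 i ` X \<subseteq> {..<(k :: nat)}"
  by (auto simp: transpose_def)

lemma lits_wf:
  assumes "l \<in> lits ar F k G" "F \<subseteq> tau"
    and G: "\<And>g. g \<in> G \<Longrightarrow> g \<in> UNFO ar tau \<and> fv g \<subseteq> {0} \<and> vars g \<subseteq> {..<k} \<and> un_normal_at False g"
  shows "l \<in> UNFO ar tau \<and> vars l \<subseteq> {..<k} \<and> un_normal_at False l"
proof -
  have *: "ren (transpose 0 i) g \<in> UNFO ar tau" "card (fv (ren (transpose 0 i) g)) \<le> 1"
    "vars (ren (transpose 0 i) g) \<subseteq> {..<k}" "un_normal_at False (ren (transpose 0 i) g)"
    if "g \<in> G" "i < k" for g i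
  proof -
    note G = G [OF that(1)]
    show "ren (transpose 0 i) g \<in> UNFO ar tau"
      using G by (intro UNFO_ren inj_transpose) simp
    have "card (fv g) \<le> card {0 :: nat}" using G by (intro card_mono) auto
    then show "card (fv (ren (transpose 0 i) g)) \<le> 1"
      by (simp add: card_fv_ren inj_transpose)
    show "vars (ren (transpose 0 i) g) \<subseteq> {..<k}"
      unfolding vars_ren using G that(2) by (intro transpose_image_subset) auto
    show "un_normal_at False (ren (transpose 0 i) g)"
      using G by (simp add: un_normal_at_ren inj_transpose)
  qed
  from assms(1) consider
      (atom) S zs where "l = Rel S zs" "S \<in> F" "length zs = ar S" "set zs \<subseteq> {..<k}"
    | (pos) g i where "g \<in> G" "i < k" "l = ren (transpose 0 i) g"
    | (neg) g i where "g \<in> G" "i < k" "l = Neg (ren (transpose 0 i) g)"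
    unfolding lits_def by blast
  then show ?thesis
  proof cases
    case atom
    then show ?thesis using assms(2) by (auto intro: UNFO.intros)
  next
    case pos
    then show ?thesis using * by blast
  next
    case neg
    then show ?thesis using * [OF neg(1,2)] by (auto intro: UNFO.intros)
  qed
qed

lemma tests_wf:
  assumes "k \<ge> 1" "finite F" "F \<subseteq> tau" "g \<in> tests ar F k j"
  shows "g \<in> UNFO ar tau \<and> fv g \<subseteq> {0} \<and> vars g \<subseteq> {..<k} \<and> un_normal_at False g"
  using assms(4)
proof (induction j arbitrary: g)
  case (Suc j)
  then obtain L where L: "L \<subseteq> lits ar F k (tests ar F k j)"
    and g: "g = exs [1..<k] (Conj L) \<or> g = exs [0..<k] (Conj L)" by auto
  have fin: "finite L"
    by (rule finite_subset [OF L finite_lits [OF assms(2) finite_tests [OF assms(2)]]])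
  have wf: "Conj L \<in> UNFO ar tau \<and> vars (Conj L) \<subseteq> {..<k} \<and> un_normal_at False (Conj L)"
  proof (rule Conj_closed [OF fin])
    show "p \<in> UNFO ar tau \<and> vars p \<subseteq> {..<k} \<and> un_normal_at False p" if "p \<in> L" for p
      using lits_wf [OF subsetD [OF L that] assms(3) Suc.IH] by blast
  qed (use assms(1) in \<open>auto intro: UNFO.intros\<close>)
  have fv: "fv (exs ys (Conj L)) \<subseteq> {0}" "vars (exs ys (Conj L)) \<subseteq> {..<k}"
    if "ys = [1..<k] \<or> ys = [0..<k]" for ys
    using that wf fv_subset_vars [of "Conj L"] assms(1) by (auto simp: fv_exs vars_exs)
  have "card (fv (exs ys (Conj L))) \<le> 1" if "ys = [1..<k] \<or> ys = [0..<k]" for ys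
    using card_mono [OF _ fv(1) [OF that]] by simp
  then have "exs ys (Conj L) \<in> UNFO ar tau \<and> fv (exs ys (Conj L)) \<subseteq> {0} \<and>
      vars (exs ys (Conj L)) \<subseteq> {..<k} \<and> un_normal_at False (exs ys (Conj L))"
    if "ys = [1..<k] \<or> ys = [0..<k]" for ys
    using that wf fv [OF that] UNFO_exs [of "Conj L" ar tau ys] un_normal_at_exs [of "Conj L" False ys]
    by blast
  from this [of "[1..<k]"] this [of "[0..<k]"] show ?case using g by metis
qed simp

lemma sat_test_ren:
  assumes "fv g \<subseteq> {0}"
  shows "sat M s (ren (transpose 0 i) g) \<longleftrightarrow> sat M (\<lambda>_. s i) g"
  unfolding sat_ren [OF inj_transpose] using assms by (intro sat_cong) auto

text \<open>The conjunction describes the tuple \<open>s\<close> completely at level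
  \<open>j\<close>. Each test occurs in it either plainly or negated, whence an equivalence at every
  coordinate; atoms transfer in one direction only.\<close>

lemma lits_transfer:
  assumes "k \<ge> 1" "finite F" "universe N \<noteq> {}"
    and t: "sat N t (Conj {l \<in> lits ar F k (tests ar F k j). sat M s l})"
  shows "i < k \<Longrightarrow> agree ar F k j M (s i) N (t i)"
    and "S \<in> F \<Longrightarrow> length zs = ar S \<Longrightarrow> set zs \<subseteq> {..<k} \<Longrightarrow> map s zs \<in> interp M S \<Longrightarrow>
      map t zs \<in> interp N S"
proof -
  have fin: "finite (lits ar F k (tests ar F k j))"
    by (rule finite_lits [OF assms(2) finite_tests [OF assms(2)]])
  have *: "sat N t l" if "l \<in> lits ar F k (tests ar F k j)" "sat M s l" for l
    using t that sat_Conj [of "{l \<in> lits ar F k (tests ar F k j). sat M s l}" N t] fin assms(3)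
    by simp
  show "agree ar F k j M (s i) N (t i)" if i: "i < k"
    unfolding agree_def
  proof
    fix g assume g: "g \<in> tests ar F k j"
    have "ren (transpose 0 i) g \<in> lits ar F k (tests ar F k j)"
      "Neg (ren (transpose 0 i) g) \<in> lits ar F k (tests ar F k j)"
      using g i unfolding lits_def by blast+
    from this [THEN *] show "sat M (\<lambda>_. s i) g \<longleftrightarrow> sat N (\<lambda>_. t i) g"
      using tests_wf [OF assms(1,2) order_refl g] by (auto simp: sat_test_ren)
  qed
  show "map t zs \<in> interp N S"
    if "S \<in> F" "length zs = ar S" "set zs \<subseteq> {..<k}" "map s zs \<in> interp M S"
    using * [of "Rel S zs"] that unfolding lits_def by auto
qed

text \<open>Closing all \<open>k\<close> variables asserts that a tuple of the given description
  exists anywhere. Agreement on sentences one level higher is therefore enough, with no agreeing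
  pair presupposed; the nullary case relies on this.\<close>

lemma agree_Suc_total:
  assumes "k \<ge> 1" "finite F" "universe M \<noteq> {}" "universe N \<noteq> {}"
    and closed: "\<And>g. g \<in> tests ar F k (Suc j) \<Longrightarrow> fv g = {} \<Longrightarrow> sat M s g \<longleftrightarrow> sat N s' g"
    and y: "y \<in> universe M"
  shows "\<exists>z\<in>universe N. agree ar F k j M y N z"
proof -
  let ?L = "{l \<in> lits ar F k (tests ar F k j). sat M (\<lambda>_. y) l}"
  let ?g = "exs [0..<k] (Conj ?L)"
  have fin: "finite ?L"
    using finite_lits [OF assms(2) finite_tests [OF assms(2)]] by simp
  have "?L \<in> Pow (lits ar F k (tests ar F k j))" by blast
  then have g: "?g \<in> tests ar F k (Suc j)" unfolding tests.simps by blast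
  have fv: "fv ?g = {}"
    using tests_wf [OF assms(1,2) order_refl g] assms(1) by (auto simp: fv_exs)
  have "sat M s ?g"
  proof -
    have "sat M (\<lambda>_. y) (Conj ?L)"
      using fin assms(3) by (simp add: sat_Conj)
    then have "sat M (\<lambda>_. y) ?g"
      unfolding sat_exs by (intro exI [of _ "\<lambda>_. y"]) (use y in simp)
    then show ?thesis using sat_cong [of ?g "\<lambda>_. y" s M] fv by blast
  qed
  then have "sat N s' ?g" using closed [OF g fv] by blast
  then obtain t where t: "\<forall>x\<in>set [0..<k]. t x \<in> universe N" "sat N t (Conj ?L)"
    unfolding sat_exs by blast
  then have "t 0 \<in> universe N" using assms(1) by auto
  moreover have "agree ar F k j M y N (t 0)"
    using lits_transfer(1) [OF assms(1,2,4) t(2), of 0] assms(1) by simp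
  ultimately show ?thesis by blast
qed

text \<open>The description of \<open>X\<close> with every variable except that of \<open>c\<close>
  quantified away is a test at \<open>c\<close>. Its truth at \<open>d\<close> returns a tuple of
  \<open>N\<close> with the same description, which speaks of tests one level lower.\<close>

lemma agree_Suc_step:
  assumes "k \<ge> 1" "finite F" and str: "is_structure ar F M" "universe N \<noteq> {}"
    and agree: "agree ar F k (Suc j) M c N d"
    and X: "finite X" "X \<subseteq> universe M" "card X \<le> k" and c: "c \<in> X" and d: "d \<in> universe N"
  shows "\<exists>f. f c = d \<and> (\<forall>x. f x \<in> universe N) \<and> (\<forall>x\<in>X. agree ar F k j M x N (f x)) \<and>
    (\<forall>S\<in>F. \<forall>ys\<in>interp M S. set ys \<subseteq> X \<longrightarrow> map f ys \<in> interp N S)"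
proof -
  obtain xs where xs: "set xs = X - {c}" "distinct xs"
    using X(1) finite_distinct_list by (metis finite_Diff)
  have len: "length xs < k"
    using distinct_card [OF xs(2)] xs(1) X c
    by (metis One_nat_def Suc_le_lessD card_Suc_Diff1)
  define s where "s n = (if n < length (c # xs) then (c # xs) ! n else c)" for n
  have s0: "s 0 = c" unfolding s_def by simp
  have set_eq: "set (c # xs) = X" using xs(1) c by auto
  have sX: "s n \<in> X" for n
  proof (cases "n < length (c # xs)")
    case True
    then show ?thesis using nth_mem [OF True] unfolding set_eq s_def by simp
  qed (simp add: s_def c)
  have surj: "\<exists>n<k. s n = x" if "x \<in> X" for x
  proof -
    have "x \<in> set (c # xs)" using that by (simp only: set_eq)
    then obtain n where n: "n < length (c # xs)" "(c # xs) ! n = x"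
      unfolding in_set_conv_nth by blast
    have "s n = x" unfolding s_def if_P [OF n(1)] by (rule n(2))
    moreover have "n < k" using n(1) len by simp
    ultimately show ?thesis by blast
  qed
  \<comment> \<open>Padding makes \<open>c\<close> the value of several variables, so index
    \<open>0\<close> is forced for it: only \<open>t 0\<close> is known to be \<open>d\<close>.
    Fixing one index per element makes the image well defined even if \<open>t\<close> separates
    variables on which \<open>s\<close> agrees.\<close>
  define idx where "idx x = (if x = c then 0 else SOME n. n < k \<and> s n = x)" for x
  have idx: "idx x < k" "s (idx x) = x" if "x \<in> X" for x
    using someI_ex [OF surj [OF that]] s0 assms(1) unfolding idx_def by simp_all
  let ?L = "{l \<in> lits ar F k (tests ar F k j). sat M s l}"
  let ?g = "exs [1..<k] (Conj ?L)"
  have fin: "finite ?L"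
    using finite_lits [OF assms(2) finite_tests [OF assms(2)]] by simp
  have "?L \<in> Pow (lits ar F k (tests ar F k j))" by blast
  then have g: "?g \<in> tests ar F k (Suc j)" unfolding tests.simps by blast
  have fv: "fv ?g \<subseteq> {0}" using tests_wf [OF assms(1,2) order_refl g] by blast
  have "universe M \<noteq> {}" using str(1) unfolding is_structure_def by blast
  then have "sat M s (Conj ?L)" using fin by (simp add: sat_Conj)
  then have "sat M s ?g"
    unfolding sat_exs by (intro exI [of _ s]) (use sX X(2) in auto)
  then have "sat M (\<lambda>_. c) ?g"
    using sat_cong [of ?g s "\<lambda>_. c" M] fv s0 by auto
  then have "sat N (\<lambda>_. d) ?g"
    using agree g unfolding agree_def by blast
  then obtain t where t: "\<forall>x\<in>set [1..<k]. t x \<in> universe N" "\<forall>x. x \<notin> set [1..<k] \<longrightarrow> t x = d"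
    "sat N t (Conj ?L)"
    unfolding sat_exs by blast
  have tN: "t n \<in> universe N" for n using t(1,2) d by metis
  have t0: "t 0 = d" using t(2) by simp
  note tr = lits_transfer [OF assms(1,2) str(2) t(3)]
  show ?thesis
  proof (intro exI [of _ "\<lambda>x. t (idx x)"] conjI ballI allI impI)
    show "t (idx c) = d" unfolding idx_def using t0 by simp
    show "agree ar F k j M x N (t (idx x))" if "x \<in> X" for x
      using tr(1) [of "idx x"] idx [OF that] by simp
    show "map (\<lambda>x. t (idx x)) ys \<in> interp N S"
      if "S \<in> F" "ys \<in> interp M S" "set ys \<subseteq> X" for S ys
    proof -
      have "length ys = ar S" using str(1) that unfolding is_structure_def by blast
      moreover have "map s (map idx ys) = ys"
        using idx(2) that(3) by (auto intro!: map_idI)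
      moreover have "set (map idx ys) \<subseteq> {..<k}"
        using idx(1) that(3) by auto
      ultimately have "map t (map idx ys) \<in> interp N S"
        using tr(2) [of S "map idx ys"] that by simp
      then show ?thesis by (simp add: comp_def)
    qed
  qed (rule tN)
qed

section \<open>Amalgamation and explicit definitions\<close>

text \<open>The projections are parameters so that exchanging them, along with the models, gives a
  second structure on the same set of pairs. The condition on symbols of \<open>tau\<close> is
  symmetric under this exchange.\<close>

definition amalgam ::
  "'e set \<Rightarrow> ('e \<Rightarrow> 'a) \<Rightarrow> ('e \<Rightarrow> 'b) \<Rightarrow> ('a, 'r) struc \<Rightarrow> ('b, 'r) struc \<Rightarrow> 'r set \<Rightarrow> ('e, 'r) struc" where
  "amalgam W \<pi> \<pi>' M N tau = Struc W (\<lambda>S. {es. set es \<subseteq> W \<and> map \<pi> es \<in> interp M S \<and>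
     (S \<in> tau \<longrightarrow> map \<pi>' es \<in> interp N S)})"

text \<open>In essence the forward half of a UN-bisimulation of width \<open>k\<close>. The other
  half is the same condition for the transposed relation with the models exchanged.\<close>

definition back_forth ::
  "'r set \<Rightarrow> nat \<Rightarrow> ('a \<Rightarrow> 'b \<Rightarrow> bool) \<Rightarrow> ('a, 'r) struc \<Rightarrow> ('b, 'r) struc \<Rightarrow> bool" where
  "back_forth tau k Z M N \<longleftrightarrow> (\<forall>c\<in>universe M. \<exists>d\<in>universe N. Z c d) \<and>
     (\<forall>X c d. finite X \<and> X \<subseteq> universe M \<and> card X \<le> k \<and> c \<in> X \<and> d \<in> universe N \<and> Z c d \<longrightarrow>
       (\<exists>f. f c = d \<and> (\<forall>x\<in>X. f x \<in> universe N \<and> Z x (f x)) \<and>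
         (\<forall>S\<in>tau. \<forall>ys\<in>interp M S. set ys \<subseteq> X \<longrightarrow> map f ys \<in> interp N S)))"

lemma amalgam_simps [simp]:
  "universe (amalgam W \<pi> \<pi>' M N tau) = W"
  "interp (amalgam W \<pi> \<pi>' M N tau) S = {es. set es \<subseteq> W \<and> map \<pi> es \<in> interp M S \<and>
     (S \<in> tau \<longrightarrow> map \<pi>' es \<in> interp N S)}"
  unfolding amalgam_def by simp_all

lemma is_structure_amalgam:
  assumes "is_structure ar sig M" "W \<noteq> {}"
  shows "is_structure ar sig (amalgam W \<pi> \<pi>' M N tau)"
  unfolding is_structure_def
proof (intro conjI ballI subsetI CollectI)
  fix S es assume "S \<in> sig" "es \<in> interp (amalgam W \<pi> \<pi>' M N tau) S"
  then have "length (map \<pi> es) = ar S"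
    using assms(1) unfolding is_structure_def amalgam_simps by blast
  then show "length es = ar S" by simp
qed (use assms(2) in auto)

text \<open>An element \<open>x\<close> is lifted to the pair of \<open>x\<close> and
  \<open>f x\<close>, where \<open>f\<close> is the local homomorphism through the pair
  \<open>e\<close>. Preservation of \<open>tau\<close> by \<open>f\<close> is what the amalgam
  requires of the second coordinate; other symbols are read off in \<open>M\<close> alone.\<close>

lemma covers_amalgam:
  assumes bf: "back_forth tau k Z M N" and ne: "universe M \<noteq> {}"
    and pair: "\<And>x y. \<pi> (pr x y) = x" "\<And>x y. \<pi>' (pr x y) = y" "\<And>e. pr (\<pi> e) (\<pi>' e) = e"
    and W: "W = {e. \<pi> e \<in> universe M \<and> \<pi>' e \<in> universe N \<and> Z (\<pi> e) (\<pi>' e)}"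
  shows "covers sig k \<pi> (amalgam W \<pi> \<pi>' M N tau) M"
  unfolding covers_def
proof (intro conjI allI impI ballI)
  note bf = conjunct1 [OF bf [unfolded back_forth_def]] conjunct2 [OF bf [unfolded back_forth_def], rule_format]
  have "x \<in> \<pi> ` W" if "x \<in> universe M" for x
  proof -
    from bspec [OF bf(1) that] obtain y where "y \<in> universe N" "Z x y" by (rule bexE)
    then have "pr x y \<in> W" unfolding W mem_Collect_eq pair(1,2) using that by blast
    from imageI [OF this, of \<pi>] show ?thesis by (simp add: pair(1))
  qed
  moreover have "\<pi> ` W \<subseteq> universe M" unfolding W by blast
  ultimately show img: "\<pi> ` universe (amalgam W \<pi> \<pi>' M N tau) = universe M"
    unfolding amalgam_simps by blast
  show "universe (amalgam W \<pi> \<pi>' M N tau) \<noteq> {}" using img ne by blast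
  show "map \<pi> es \<in> interp M S" if "es \<in> interp (amalgam W \<pi> \<pi>' M N tau) S" for S es
    using that by simp
  fix X e
  assume X: "finite X \<and> X \<subseteq> universe M \<and> card X \<le> k \<and>
    e \<in> universe (amalgam W \<pi> \<pi>' M N tau) \<and> \<pi> e \<in> X"
  then have e: "e \<in> W" "\<pi>' e \<in> universe N" "Z (\<pi> e) (\<pi>' e)" using W by auto
  with bf(2) [of X "\<pi> e" "\<pi>' e"] X
  obtain f where f: "f (\<pi> e) = \<pi>' e" "\<forall>x\<in>X. f x \<in> universe N \<and> Z x (f x)"
    "\<forall>S\<in>tau. \<forall>ys\<in>interp M S. set ys \<subseteq> X \<longrightarrow> map f ys \<in> interp N S"
    by auto
  define h where "h x = (if x \<in> X then pr x (f x) else e)" for x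
  have hW: "h x \<in> W" for x
    using f(2) X pair e(1) unfolding h_def W by auto
  have "map h ys \<in> interp (amalgam W \<pi> \<pi>' M N tau) S"
    if S: "S \<in> sig" "ys \<in> interp M S" "set ys \<subseteq> X" for S ys
  proof -
    have "map \<pi> (map h ys) = ys"
      using S(3) by (auto simp: h_def pair intro!: map_idI)
    moreover have "map \<pi>' (map h ys) = map f ys"
      using S(3) by (auto simp: h_def pair)
    moreover have "set (map h ys) \<subseteq> W" using hW by auto
    ultimately show ?thesis using S f(3) by (simp del: map_map)
  qed
  then have "lifts sig \<pi> (amalgam W \<pi> \<pi>' M N tau) M X h"
    unfolding lifts_def using hW pair(1) by (simp add: h_def)
  moreover have "h (\<pi> e) = e" using X f(1) pair(3) unfolding h_def by simp
  ultimately show "\<exists>h. h (\<pi> e) = e \<and> lifts sig \<pi> (amalgam W \<pi> \<pi>' M N tau) M X h" by blast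
qed

text \<open>Every back-and-forth step lowers the level of agreement by one. In the ultraproduct the
  levels \<open>D\<close> are infinite, so agreement up to a finite loss is a back-and-forth system.\<close>

lemma back_forth_uprod:
  fixes Ms Ns :: "'i \<Rightarrow> ('u, 'r) struc"
  assumes M: "ultraproduct U Ms ar sig" and N: "ultraproduct U Ns ar sig" and tau: "tau \<subseteq> sig"
    and F: "\<And>i. finite (F i)" "\<And>i. F i \<subseteq> tau" "\<And>S. S \<in> tau \<Longrightarrow> eventually (\<lambda>i. S \<in> F i) U"
    and K: "\<And>i. K i \<ge> 1" "eventually (\<lambda>i. k \<le> K i) U"
    and D: "\<And>m. eventually (\<lambda>i. m \<le> D i) U"
    and Z: "\<And>c d. Z c d \<longleftrightarrow>
      (\<exists>m. eventually (\<lambda>i. agree ar (F i) (K i) (D i - m) (Ms i) (c i) (Ns i) (d i)) U)"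
    and base: "Z c0 d0"
  shows "back_forth tau k Z (ultraproduct.uprod U Ms) (ultraproduct.uprod U Ns)"
proof -
  interpret P: ultraproduct U Ms ar sig by (rule M)
  interpret Q: ultraproduct U Ns ar sig by (rule N)
  have ne: "universe (Ms i) \<noteq> {}" "universe (Ns i) \<noteq> {}" for i
    using P.str [of i] Q.str [of i] unfolding is_structure_def by auto
  have strF: "is_structure ar (F i) (Ms i)" for i
    using P.str [of i] F(2) [of i] tau unfolding is_structure_def by blast
  have total: "\<exists>d\<in>universe Q.uprod. Z c d" if c: "c \<in> universe P.uprod" for c
  proof -
    obtain m where m: "eventually (\<lambda>i. agree ar (F i) (K i) (D i - m) (Ms i) (c0 i) (Ns i) (d0 i)) U"
      using base Z by blast
    \<comment> \<open>Subtraction is truncated, so \<open>Suc m \<le> D i\<close> is what makes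
      \<open>D i - m\<close> the successor of \<open>D i - Suc m\<close>. It fails on a negligible
      set of indices, where any element may be chosen.\<close>
    let ?ok = "\<lambda>i. agree ar (F i) (K i) (D i - m) (Ms i) (c0 i) (Ns i) (d0 i) \<and> Suc m \<le> D i"
    have "\<exists>z. z \<in> universe (Ns i) \<and>
        (?ok i \<longrightarrow> agree ar (F i) (K i) (D i - Suc m) (Ms i) (c i) (Ns i) z)" for i
    proof (cases "?ok i")
      case True
      then have "agree ar (F i) (K i) (Suc (D i - Suc m)) (Ms i) (c0 i) (Ns i) (d0 i)"
        by (simp add: Suc_diff_Suc Suc_le_lessD)
      then have "\<exists>z\<in>universe (Ns i). agree ar (F i) (K i) (D i - Suc m) (Ms i) (c i) (Ns i) z"
        using c P.uprod_choices
        by (intro agree_Suc_total [OF K(1) F(1) ne, where s = "\<lambda>_. c0 i" and s' = "\<lambda>_. d0 i"])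
          (auto simp: agree_def)
      then show ?thesis by blast
    qed (use ne in blast)
    then obtain d where d: "\<And>i. d i \<in> universe (Ns i)"
      "\<And>i. ?ok i \<Longrightarrow> agree ar (F i) (K i) (D i - Suc m) (Ms i) (c i) (Ns i) (d i)"
      by metis
    then have dc: "d \<in> Q.choices" unfolding Q.choices_def by blast
    have "eventually (\<lambda>i. agree ar (F i) (K i) (D i - Suc m) (Ms i) (c i) (Ns i) (Q.rep d i)) U"
      using m D [of "Suc m"] Q.rep(2) [OF dc] by eventually_elim (use d(2) in simp)
    then have "Z c (Q.rep d)" using Z by blast
    with dc show ?thesis by auto
  qed
  have step: "\<exists>f. f c = d \<and> (\<forall>x\<in>X. f x \<in> universe Q.uprod \<and> Z x (f x)) \<and>
      (\<forall>S\<in>tau. \<forall>ys\<in>interp P.uprod S. set ys \<subseteq> X \<longrightarrow> map f ys \<in> interp Q.uprod S)"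
    if X: "finite X" "X \<subseteq> universe P.uprod" "card X \<le> k" and c: "c \<in> X"
      and d: "d \<in> universe Q.uprod" "Z c d" for X c d
  proof -
    obtain m where m: "eventually (\<lambda>i. agree ar (F i) (K i) (D i - m) (Ms i) (c i) (Ns i) (d i)) U"
      using d(2) Z by blast
    let ?ok = "\<lambda>i. agree ar (F i) (K i) (D i - m) (Ms i) (c i) (Ns i) (d i) \<and> Suc m \<le> D i \<and> k \<le> K i"
    let ?Y = "\<lambda>i. (\<lambda>x. x i) ` X"
    \<comment> \<open>Maps are chosen on coordinates, index by index. Distinct elements of
      \<open>X\<close> may share a coordinate, which can only shrink the set to be mapped.\<close>
    define lift where "lift i f \<longleftrightarrow> (\<forall>x. f x \<in> universe (Ns i)) \<and> (?ok i \<longrightarrow> f (c i) = d i \<and>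
        (\<forall>x\<in>?Y i. agree ar (F i) (K i) (D i - Suc m) (Ms i) x (Ns i) (f x)) \<and>
        (\<forall>S\<in>F i. \<forall>ys\<in>interp (Ms i) S. set ys \<subseteq> ?Y i \<longrightarrow> map f ys \<in> interp (Ns i) S))" for i f
    have "\<exists>f. lift i f" for i
    proof (cases "?ok i")
      case True
      then have ag: "agree ar (F i) (K i) (Suc (D i - Suc m)) (Ms i) (c i) (Ns i) (d i)"
        by (simp add: Suc_diff_Suc Suc_le_lessD)
      have "finite (?Y i)" "?Y i \<subseteq> universe (Ms i)" using X(1,2) P.uprod_choices by auto
      moreover have "card (?Y i) \<le> K i"
        using card_image_le [OF X(1), of "\<lambda>x. x i"] X(3) True by linarith
      moreover have "c i \<in> ?Y i" using c by blast
      moreover have "d i \<in> universe (Ns i)" using d(1) Q.uprod_choices by simp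
      ultimately obtain f where "f (c i) = d i" "\<forall>x. f x \<in> universe (Ns i)"
        "\<forall>x\<in>?Y i. agree ar (F i) (K i) (D i - Suc m) (Ms i) x (Ns i) (f x)"
        "\<forall>S\<in>F i. \<forall>ys\<in>interp (Ms i) S. set ys \<subseteq> ?Y i \<longrightarrow> map f ys \<in> interp (Ns i) S"
        using agree_Suc_step [OF K(1) F(1) strF ne(2) ag, of "?Y i"] by meson
      then have "lift i f" unfolding lift_def by blast
      then show ?thesis by blast
    next
      case False
      obtain z where "z \<in> universe (Ns i)" using ne(2) by blast
      with False have "lift i (\<lambda>_. z)" unfolding lift_def by blast
      then show ?thesis by blast
    qed
    then obtain g where "\<And>i. lift i (g i)" by metis
    then have g: "\<And>i x. g i x \<in> universe (Ns i)"
      "\<And>i. ?ok i \<Longrightarrow> g i (c i) = d i"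
      "\<And>i x. ?ok i \<Longrightarrow> x \<in> ?Y i \<Longrightarrow> agree ar (F i) (K i) (D i - Suc m) (Ms i) x (Ns i) (g i x)"
      "\<And>i S ys. ?ok i \<Longrightarrow> S \<in> F i \<Longrightarrow> ys \<in> interp (Ms i) S \<Longrightarrow> set ys \<subseteq> ?Y i \<Longrightarrow>
        map (g i) ys \<in> interp (Ns i) S"
      unfolding lift_def by blast+
    define f where "f x = Q.rep (\<lambda>i. g i (x i))" for x
    have ch: "(\<lambda>i. g i (x i)) \<in> Q.choices" for x
      unfolding Q.choices_def using g(1) by blast
    have fQ: "f x \<in> Q.rep ` Q.choices" for x unfolding f_def using ch by blast
    have f: "eventually (\<lambda>i. f x i = g i (x i)) U" for x
      unfolding f_def by (rule Q.rep(2) [OF ch])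
    have ok: "eventually ?ok U"
      using m D [of "Suc m"] K(2) by eventually_elim simp
    have "f c = d"
    proof (rule Q.uprod_eqI [OF fQ])
      show "eventually (\<lambda>i. f c i = d i) U"
        using f [of c] ok by eventually_elim (use g(2) in simp)
    qed (use d(1) in simp)
    moreover have "Z x (f x)" if "x \<in> X" for x
    proof -
      have "eventually (\<lambda>i. agree ar (F i) (K i) (D i - Suc m) (Ms i) (x i) (Ns i) (f x i)) U"
        using f [of x] ok by eventually_elim (use g(3) that in simp)
      then show ?thesis using Z by blast
    qed
    moreover have "map f ys \<in> interp Q.uprod S"
      if S: "S \<in> tau" "ys \<in> interp P.uprod S" "set ys \<subseteq> X" for S ys
    proof -
      have ys: "eventually (\<lambda>i. map (\<lambda>x. x i) ys \<in> interp (Ms i) S) U" using S(2) by simp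
      have "eventually (\<lambda>i. \<forall>x\<in>set ys. f x i = g i (x i)) U"
        using f by (intro eventually_ball_finite) auto
      then have "eventually (\<lambda>i. map (\<lambda>x. x i) (map f ys) \<in> interp (Ns i) S) U"
        using ys ok F(3) [OF S(1)]
      proof eventually_elim
        case (elim i)
        have "set (map (\<lambda>x. x i) ys) \<subseteq> ?Y i" using S(3) by auto
        with elim have "map (g i) (map (\<lambda>x. x i) ys) \<in> interp (Ns i) S"
          using g(4) by blast
        moreover have "map (g i) (map (\<lambda>x. x i) ys) = map (\<lambda>x. x i) (map f ys)"
          using elim(1) by simp
        ultimately show ?case by (simp only:)
      qed
      moreover have "set (map f ys) \<subseteq> Q.rep ` Q.choices" using fQ by auto
      ultimately show ?thesis by simp
    qed
    ultimately show ?thesis using fQ by (intro exI [of _ f]) simp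
  qed
  show ?thesis
    unfolding back_forth_def
    by (intro conjI ballI allI impI; (elim conjE)?; (rule total step; assumption)?)
qed

text \<open>\<open>pres\<close> is the only trace of the width of \<open>T\<close>: it admits
  exactly the covering widths that \<open>\<kappa>\<close> eventually reaches. It is stated at the
  types of the amalgam and the ultraproduct, as a hypothesis cannot be polymorphic.
  \<open>replicate (ar R) a\<close> treats arities one and zero alike.\<close>

lemma separated_contradiction:
  fixes ar :: "'r \<Rightarrow> nat" and T :: "'r fm set" and \<kappa> :: "nat \<Rightarrow> nat"
  assumes inf: "infinite (UNIV :: 'u set)" and sig: "sig \<lesssim> (UNIV :: 'u set)"
    and T: "UNFO_theory ar sig T" and R: "R \<in> sig" "R \<notin> tau" and tau: "tau \<subseteq> sig"
    and impl: "implicitly_defines TYPE('u) ar sig T R tau"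
    and \<kappa>: "\<And>n. \<kappa> n \<ge> 1"
    and pres: "\<And>(A :: (('r set \<times> nat \<Rightarrow> 'u) \<times> ('r set \<times> nat \<Rightarrow> 'u), 'r) struc)
        (M :: ('r set \<times> nat \<Rightarrow> 'u, 'r) struc) \<pi>.
      (\<And>k. eventually (\<lambda>n. k \<le> \<kappa> n) sequentially \<Longrightarrow> covers sig k \<pi> A M) \<Longrightarrow> is_model M T \<Longrightarrow>
      is_model A T"
    and sep: "\<And>F n. finite F \<Longrightarrow> F \<subseteq> tau \<Longrightarrow> \<exists>(M :: ('u, 'r) struc) (N :: ('u, 'r) struc) a b.
      is_structure ar sig M \<and> is_structure ar sig N \<and> is_model M T \<and> is_model N T \<and>
      a \<in> universe M \<and> b \<in> universe N \<and> agree ar F (\<kappa> n) n M a N b \<and>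
      replicate (ar R) a \<in> interp M R \<and> replicate (ar R) b \<notin> interp N R"
  shows False
proof -
  \<comment> \<open>The fallback keeps every \<open>F i\<close> finite and inside
    \<open>tau\<close>; along the ultrafilter chosen below it is used at negligibly many
    indices.\<close>
  define F where "F i = (if finite (fst i) \<and> fst i \<subseteq> tau then fst i else {})" for i :: "'r set \<times> nat"
  have F: "finite (F i)" "F i \<subseteq> tau" for i unfolding F_def by auto
  define sepd where "sepd i = (\<lambda>(M :: ('u, 'r) struc, N :: ('u, 'r) struc, a, b).
    is_structure ar sig M \<and> is_structure ar sig N \<and> is_model M T \<and> is_model N T \<and>
    a \<in> universe M \<and> b \<in> universe N \<and> agree ar (F i) (\<kappa> (snd i)) (snd i) M a N b \<and>
    replicate (ar R) a \<in> interp M R \<and> replicate (ar R) b \<notin> interp N R)" for i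
  have "\<exists>q. sepd i q" for i
    using sep [OF F, of i "snd i"] unfolding sepd_def by simp
  then obtain q where q: "\<And>i. sepd i (q i)" by metis
  define Ms Ns a b where "Ms i = fst (q i)" and "Ns i = fst (snd (q i))"
    and "a i = fst (snd (snd (q i)))" and "b i = snd (snd (snd (q i)))" for i
  have str: "\<And>i. is_structure ar sig (Ms i)" "\<And>i. is_structure ar sig (Ns i)"
    and mod: "\<And>i. is_model (Ms i) T" "\<And>i. is_model (Ns i) T"
    and ab: "\<And>i. a i \<in> universe (Ms i)" "\<And>i. b i \<in> universe (Ns i)"
      "\<And>i. agree ar (F i) (\<kappa> (snd i)) (snd i) (Ms i) (a i) (Ns i) (b i)"
    and Rab: "\<And>i. replicate (ar R) (a i) \<in> interp (Ms i) R"
      "\<And>i. replicate (ar R) (b i) \<notin> interp (Ns i) R"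
    using q unfolding sepd_def Ms_def Ns_def a_def b_def by (simp_all add: case_prod_beta)
  \<comment> \<open>Along an ultrafilter below this product each symbol of \<open>tau\<close>
    eventually enters \<open>F i\<close> and each depth is eventually passed.\<close>
  let ?G = "finite_subsets_at_top tau \<times>\<^sub>F sequentially"
  have "?G \<noteq> bot" by (simp add: prod_filter_eq_bot)
  then obtain U where U: "U \<le> ?G" "U \<noteq> bot"
    "\<And>P. eventually P U \<or> eventually (\<lambda>i. \<not> P i) U"
    by (rule ex_ultrafilter) blast
  have fst: "eventually (\<lambda>i. P (fst i)) U" if "eventually P (finite_subsets_at_top tau)" for P
    by (rule filter_leD [OF U(1)])
      (use that in \<open>auto simp: eventually_prod_filter intro!: exI [of _ P] exI [of _ "\<lambda>_ :: nat. True"]\<close>)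
  have snd: "eventually (\<lambda>i. P (snd i)) U" if "eventually P sequentially" for P
    by (rule filter_leD [OF U(1)])
      (use that in \<open>auto simp: eventually_prod_filter intro!: exI [of _ "\<lambda>_ :: 'r set. True"] exI [of _ P]\<close>)
  have F_ev: "eventually (\<lambda>i. S \<in> F i) U" if "S \<in> tau" for S
  proof -
    have "eventually (\<lambda>X. finite X \<and> X \<subseteq> tau \<and> S \<in> X) (finite_subsets_at_top tau)"
      unfolding eventually_finite_subsets_at_top using that by (intro exI [of _ "{S}"]) auto
    from fst [OF this] show ?thesis by eventually_elim (simp add: F_def)
  qed
  interpret P: ultraproduct U Ms ar sig by unfold_locales (use U str in auto)
  interpret Q: ultraproduct U Ns ar sig by unfold_locales (use U str in auto)
  define Z where "Z c d \<longleftrightarrow> (\<exists>m. eventually (\<lambda>i.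
    agree ar (F i) (\<kappa> (snd i)) (snd i - m) (Ms i) (c i) (Ns i) (d i)) U)" for c d
  have Z': "Z c d \<longleftrightarrow> (\<exists>m. eventually (\<lambda>i.
    agree ar (F i) (\<kappa> (snd i)) (snd i - m) (Ns i) (d i) (Ms i) (c i)) U)" for c d
    unfolding Z_def
    by (intro ex_cong1 arg_cong [where f = "\<lambda>P. eventually P U"] ext agree_commute)
  have ch: "a \<in> P.choices" "b \<in> Q.choices"
    unfolding P.choices_def Q.choices_def using ab by auto
  let ?a = "P.rep a" and ?b = "Q.rep b"
  have "eventually (\<lambda>i. agree ar (F i) (\<kappa> (snd i)) (snd i - 0) (Ms i) (?a i) (Ns i) (?b i)) U"
    using P.rep(2) [OF ch(1)] Q.rep(2) [OF ch(2)] by eventually_elim (use ab(3) in simp)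
  then have Zab: "Z ?a ?b" unfolding Z_def by blast
  have lev: "eventually (\<lambda>i. m \<le> snd i) U" for m
    by (rule snd) (rule eventually_ge_at_top)
  have bf: "back_forth tau k Z P.uprod Q.uprod" "back_forth tau k (\<lambda>d c. Z c d) Q.uprod P.uprod"
    if k: "eventually (\<lambda>n. k \<le> \<kappa> n) sequentially" for k
  proof -
    show "back_forth tau k Z P.uprod Q.uprod"
      by (rule back_forth_uprod [where F = F and K = "\<lambda>i. \<kappa> (snd i)" and D = snd and Z = Z,
            OF P.ultraproduct_axioms Q.ultraproduct_axioms tau])
        (rule F F_ev \<kappa> snd [OF k] lev Z_def Zab; assumption?)+
    show "back_forth tau k (\<lambda>d c. Z c d) Q.uprod P.uprod"
      by (rule back_forth_uprod [where F = F and K = "\<lambda>i. \<kappa> (snd i)" and D = snd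
            and Z = "\<lambda>d c. Z c d", OF Q.ultraproduct_axioms P.ultraproduct_axioms tau])
        (rule F F_ev \<kappa> snd [OF k] lev Z' Zab; assumption?)+
  qed
  define W where "W = {e. fst e \<in> universe P.uprod \<and> snd e \<in> universe Q.uprod \<and> Z (fst e) (snd e)}"
  have W': "W = {e. snd e \<in> universe Q.uprod \<and> fst e \<in> universe P.uprod \<and> Z (fst e) (snd e)}"
    unfolding W_def by blast
  let ?A1 = "amalgam W fst snd P.uprod Q.uprod tau" and ?A2 = "amalgam W snd fst Q.uprod P.uprod tau"
  have e: "(?a, ?b) \<in> W" unfolding W_def using Zab ch by simp
  have cov: "covers sig k fst ?A1 P.uprod" "covers sig k snd ?A2 Q.uprod"
    if "eventually (\<lambda>n. k \<le> \<kappa> n) sequentially" for k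
    using covers_amalgam [OF bf(1) [OF that], of fst Pair snd W sig]
      covers_amalgam [OF bf(2) [OF that], of snd "\<lambda>y x. (x, y)" fst W sig]
      P.is_structure_uprod Q.is_structure_uprod W_def W'
    unfolding is_structure_def by simp_all
  have "is_model ?A1 T"
    by (rule pres, rule cov(1), assumption, rule P.is_model_uprod, rule mod(1))
  moreover have "is_model ?A2 T"
    by (rule pres, rule cov(2), assumption, rule Q.is_model_uprod, rule mod(2))
  moreover have "is_structure ar sig ?A1" "is_structure ar sig ?A2"
    by (rule is_structure_amalgam, rule P.is_structure_uprod Q.is_structure_uprod, use e in blast)+
  moreover have "interp ?A1 S = interp ?A2 S" if "S \<in> tau" for S
    using that by auto
  ultimately have "interp ?A1 R = interp ?A2 R"
    by (intro implicitly_defines_any [OF inf sig T R(1) tau impl]) simp_all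
  moreover have "replicate (ar R) (?a, ?b) \<in> interp ?A1 R"
  proof -
    have "eventually (\<lambda>i. replicate (ar R) (?a i) \<in> interp (Ms i) R) U"
      using P.rep(2) [OF ch(1)] by eventually_elim (use Rab in simp)
    then show ?thesis using e R(2) ch by (auto simp: map_replicate_const set_replicate_conv_if)
  qed
  moreover have "replicate (ar R) (?a, ?b) \<notin> interp ?A2 R"
  proof
    assume "replicate (ar R) (?a, ?b) \<in> interp ?A2 R"
    then have "eventually (\<lambda>i. replicate (ar R) (?b i) \<in> interp (Ns i) R) U"
      by simp
    then have "eventually (\<lambda>_. False) U"
      using Q.rep(2) [OF ch(2)] by eventually_elim (use Rab in simp)
    then show False using U(2) by simp
  qed
  ultimately show False by blast
qed

section \<open>Relations of arity at least two\<close>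

lemma covers_double:
  fixes A :: "('a \<times> bool, 'r) struc"
  assumes univ: "universe A = universe M \<times> UNIV" "universe M \<noteq> {}"
    and hom: "\<And>S es. S \<in> sig \<Longrightarrow> es \<in> interp A S \<Longrightarrow> map fst es \<in> interp M S"
    and copy: "\<And>S as b. S \<in> sig \<Longrightarrow> as \<in> interp M S \<Longrightarrow> map (\<lambda>a. (a, b)) as \<in> interp A S"
  shows "covers sig k fst A M"
  unfolding covers_def
proof (intro conjI allI impI ballI)
  fix X e assume X: "finite X \<and> X \<subseteq> universe M \<and> card X \<le> k \<and> e \<in> universe A \<and> fst e \<in> X"
  \<comment> \<open>All of \<open>X\<close> is lifted into the copy containing \<open>e\<close>, so
    tuples of \<open>A\<close> that cross between the copies only have to project correctly.\<close>
  define h where "h x = (if x \<in> X then (x, snd e) else e)" for x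
  have "map h ys \<in> interp A S" if "S \<in> sig" "ys \<in> interp M S" "set ys \<subseteq> X" for S ys
  proof -
    have "map h ys = map (\<lambda>a. (a, snd e)) ys" using that(3) unfolding h_def by auto
    then show ?thesis using copy [OF that(1,2)] by (simp only:)
  qed
  then have "lifts sig fst A M X h"
    unfolding lifts_def using X univ(1) by (auto simp: h_def)
  moreover have "h (fst e) = e" using X unfolding h_def by simp
  ultimately show "\<exists>h. h (fst e) = e \<and> lifts sig fst A M X h" by blast
qed (use univ hom in auto)

text \<open>In two disjoint copies of a model, a tuple of \<open>R\<close> that is not a single element may be
  repeated across the copies without affecting the theory.\<close>

lemma implicitly_defined_empty:
  fixes M :: "('u, 'r) struc"
  assumes inf: "infinite (UNIV :: 'u set)" and sig: "sig \<lesssim> (UNIV :: 'u set)"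
    and T: "UNFO_theory ar sig T" and R: "R \<in> sig" "R \<notin> tau" "ar R \<ge> 2" and tau: "tau \<subseteq> sig"
    and impl: "implicitly_defines TYPE('u) ar sig T R tau"
    and M: "is_structure ar sig M" "is_model M T"
  shows "interp M R = {}"
proof (rule ccontr)
  assume "interp M R \<noteq> {}"
  then obtain as where as: "as \<in> interp M R" by blast
  have len: "length bs = ar S" "set bs \<subseteq> universe M" if "S \<in> sig" "bs \<in> interp M S" for S bs
    using M(1) that unfolding is_structure_def by auto
  obtain x y bs where xy: "as = x # y # bs"
    using len(1) [OF R(1) as] R(3) by (metis Suc_le_length_iff numeral_2_eq_2)
  define copies :: "'r \<Rightarrow> ('u \<times> bool) list set" where
    "copies S = {map (\<lambda>a. (a, b)) cs | cs b. cs \<in> interp M S}" for S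
  \<comment> \<open>Arity at least two leaves \<open>y\<close> for the other copy, so
    \<open>tw\<close> projects to \<open>as\<close> without lying in a single copy. Adding it
    changes \<open>R\<close> and nothing else.\<close>
  define tw where "tw = (x, False) # map (\<lambda>a. (a, True)) (y # bs)"
  have tw: "map fst tw = as" unfolding tw_def xy by (simp add: comp_def)
  define A :: "('u \<times> bool) list set \<Rightarrow> ('u \<times> bool, 'r) struc" where
    "A B = Struc (universe M \<times> UNIV) (\<lambda>S. if S = R then copies S \<union> B else copies S)" for B
  have fst_A: "map fst es \<in> interp M S" if "es \<in> interp (A B) S" "B \<subseteq> {tw}" for es S B
    using that tw as unfolding A_def copies_def by (auto simp: comp_def split: if_splits)
  have A: "is_structure ar sig (A B)" "is_model (A B) T" if "B \<subseteq> {tw}" for B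
  proof -
    have ne: "universe M \<noteq> {}" using M(1) unfolding is_structure_def by blast
    show "is_structure ar sig (A B)"
      unfolding is_structure_def
    proof (intro conjI ballI subsetI CollectI)
      fix S es assume S: "S \<in> sig" "es \<in> interp (A B) S"
      note * = len [OF S(1) fst_A [OF S(2) that]]
      show "length es = ar S" using *(1) by simp
      show "z \<in> universe (A B)" if "z \<in> set es" for z
        using *(2) that unfolding A_def by (cases z) force
    qed (use ne in \<open>simp add: A_def\<close>)
    have "covers sig k fst (A B) M" for k
    proof (rule covers_double)
      show "map (\<lambda>a. (a, b)) cs \<in> interp (A B) S" if "cs \<in> interp M S" for cs b S
        using that unfolding A_def copies_def by auto
    qed (use fst_A that ne in \<open>auto simp: A_def\<close>)
    then show "is_model (A B) T" by (rule is_model_covers [OF _ T M(2)])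
  qed
  have "interp (A {}) R = interp (A {tw}) R"
    by (rule implicitly_defines_any [OF inf sig T R(1) tau impl])
      (use A R(2) in \<open>auto simp: A_def\<close>)
  then have "tw \<in> copies R" unfolding A_def by auto
  then show False unfolding copies_def tw_def by (auto simp: map_eq_Cons_conv Cons_eq_map_conv)
qed

text \<open>With at most one free variable, members of \<open>\<Gamma>\<close> may be negated, and
  complete \<open>\<Gamma>\<close>-types become formulas. The definition is the disjunction of the
  types realised together with \<open>R\<close>; by \<open>det\<close> such a type is never realised
  without it. The variable \<open>0\<close> is used by the constant sentences that end
  \<open>Conj\<close> and \<open>Disj\<close>.\<close>

lemma explicit_definition_if_determined:
  fixes R :: 'r and \<Gamma> :: "'r fm set"
  assumes fin: "finite \<Gamma>" and V: "0 \<in> V" and xs: "distinct xs" "length xs = ar R" "length xs \<le> 1"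
    and \<Gamma>: "\<And>g. g \<in> \<Gamma> \<Longrightarrow>
      g \<in> UNFO ar tau \<and> fv g \<subseteq> set xs \<and> vars g \<subseteq> V \<and> un_normal_at False g"
    and det: "\<And>(M :: ('u, 'r) struc) (N :: ('u, 'r) struc) s t.
      is_structure ar sig M \<Longrightarrow> is_structure ar sig N \<Longrightarrow> is_model M T \<Longrightarrow> is_model N T \<Longrightarrow>
      range s \<subseteq> universe M \<Longrightarrow> range t \<subseteq> universe N \<Longrightarrow> (\<And>g. g \<in> \<Gamma> \<Longrightarrow> sat M s g \<longleftrightarrow> sat N t g) \<Longrightarrow>
      sat M s (Rel R xs) \<Longrightarrow> sat N t (Rel R xs)"
  shows "\<exists>p\<in>UNFO ar tau. un_normal p \<and> vars p \<subseteq> V \<and> explicit_definition TYPE('u) ar sig T R xs p"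
proof -
  define good where "good M s \<longleftrightarrow> is_structure ar sig M \<and> is_model M T \<and> range s \<subseteq> universe M"
    for M :: "('u, 'r) struc" and s :: "nat \<Rightarrow> 'u"
  define desc where "desc P = Conj (P \<union> Neg ` (\<Gamma> - P))" for P
  define Ps where "Ps = {P. P \<subseteq> \<Gamma> \<and>
    (\<exists>(M :: ('u, 'r) struc) s. good M s \<and> sat M s (Rel R xs) \<and> P = {g \<in> \<Gamma>. sat M s g})}"
  define p where "p = Disj (desc ` Ps)"
  have finPs: "finite Ps" unfolding Ps_def using fin by simp
  have sub: "finite (P \<union> Neg ` (\<Gamma> - P))" if "P \<in> Ps" for P
    using that fin finite_subset unfolding Ps_def by auto
  let ?wf = "\<lambda>q. q \<in> UNFO ar tau \<and> fv q \<subseteq> set xs \<and> vars q \<subseteq> V \<and> un_normal_at False q"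
  have neg: "?wf (Neg g)" if "g \<in> \<Gamma>" for g
  proof -
    have "card (fv g) \<le> card (set xs)" using \<Gamma> [OF that] by (intro card_mono) auto
    also have "\<dots> \<le> 1" using xs(3) card_length le_trans by blast
    finally show ?thesis using \<Gamma> [OF that] by (auto intro: UNFO.intros)
  qed
  have "?wf (desc P)" if P: "P \<in> Ps" for P
    unfolding desc_def
  proof (rule Conj_closed [OF sub [OF P]])
    fix q assume q: "q \<in> P \<union> Neg ` (\<Gamma> - P)"
    have "P \<subseteq> \<Gamma>" using P unfolding Ps_def by blast
    with q consider "q \<in> \<Gamma>" | g where "g \<in> \<Gamma>" "q = Neg g" by blast
    then show "?wf q" by cases (use \<Gamma> neg in simp_all)
  qed (use V in \<open>auto intro: UNFO.intros\<close>)
  then have desc_wf: "?wf q" if "q \<in> desc ` Ps" for q using that by auto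
  have wf: "?wf p"
    unfolding p_def
  proof (rule Disj_closed [OF finite_imageI [OF finPs]])
    show "?wf q" if "q \<in> desc ` Ps" for q by (rule desc_wf [OF that])
  qed (use V UNFO_false in \<open>auto intro: UNFO.intros\<close>)
  have "sat M s (Rel R xs) \<longleftrightarrow> sat M s p" if g: "good M s" for M s
  proof -
    have ne: "universe M \<noteq> {}" using g unfolding good_def is_structure_def by blast
    have desc: "sat M s (desc P) \<longleftrightarrow> P = {g \<in> \<Gamma>. sat M s g}" if P: "P \<in> Ps" for P
    proof -
      have "P \<subseteq> \<Gamma>" using P unfolding Ps_def by blast
      then show ?thesis
        unfolding desc_def sat_Conj [OF sub [OF P] ne] by (auto simp: ball_Un)
    qed
    have "sat M s p \<longleftrightarrow> {g \<in> \<Gamma>. sat M s g} \<in> Ps"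
      unfolding p_def using sat_Disj [of "desc ` Ps" M s] finPs ne desc by auto
    also have "\<dots> \<longleftrightarrow> sat M s (Rel R xs)"
    proof
      assume "{g \<in> \<Gamma>. sat M s g} \<in> Ps"
      then obtain N :: "('u, 'r) struc" and t where "good N t" "sat N t (Rel R xs)"
        "{g \<in> \<Gamma>. sat M s g} = {g \<in> \<Gamma>. sat N t g}"
        unfolding Ps_def by blast
      then show "sat M s (Rel R xs)"
        using g unfolding good_def by (intro det [of N M t s]) auto
    next
      assume "sat M s (Rel R xs)"
      then show "{g \<in> \<Gamma>. sat M s g} \<in> Ps" unfolding Ps_def using g by blast
    qed
    finally show ?thesis by blast
  qed
  then have "explicit_definition TYPE('u) ar sig T R xs p"
    unfolding explicit_definition_def good_def using xs wf by blast
  then show ?thesis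
    using wf un_normal_at_mono unfolding un_normal_def by blast
qed

lemma explicit_definition_ren:
  fixes p :: "'r fm"
  assumes "inj f" "explicit_definition TYPE('u) ar sig T R xs p"
  shows "explicit_definition TYPE('u) ar sig T R (map f xs) (ren f p)"
  unfolding explicit_definition_def
proof (intro conjI allI impI)
  fix M :: "('u, 'r) struc" and s :: "nat \<Rightarrow> 'u"
  assume M: "is_structure ar sig M" "is_model M T" "range s \<subseteq> universe M"
  then have "range (s \<circ> f) \<subseteq> universe M" by auto
  with M assms(2) have "sat M (s \<circ> f) (Rel R xs) \<longleftrightarrow> sat M (s \<circ> f) p"
    unfolding explicit_definition_def by blast
  then show "sat M s (Rel R (map f xs)) \<longleftrightarrow> sat M s (ren f p)"
    by (simp add: sat_ren [OF assms(1)])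
qed (use assms in \<open>auto simp: explicit_definition_def fv_ren distinct_map intro: inj_on_subset\<close>)

text \<open>For \<open>R\<close> in \<open>tau\<close> the atom is its own definition, and
  \<open>wd\<close> provides for its \<open>ar R\<close> variables. Otherwise the definition is a
  contradiction in one variable or a combination of tests in the variables below some
  \<open>\<kappa> n\<close>, up to renaming.\<close>

lemma explicit_definition_exists:
  fixes ar :: "'r \<Rightarrow> nat" and T :: "'r fm set" and \<kappa> :: "nat \<Rightarrow> nat"
  assumes inf: "infinite (UNIV :: 'u set)" and sig: "sig \<lesssim> (UNIV :: 'u set)"
    and T: "UNFO_theory ar sig T" and R: "R \<in> sig" and tau: "tau \<subseteq> sig"
    and impl: "implicitly_defines TYPE('u) ar sig T R tau"
    and xs: "distinct xs" "length xs = ar R"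
    and \<kappa>: "\<And>n. \<kappa> n \<ge> 1" and wd: "R \<in> tau \<Longrightarrow> \<exists>n. ar R \<le> \<kappa> n"
    and pres: "\<And>(A :: (('r set \<times> nat \<Rightarrow> 'u) \<times> ('r set \<times> nat \<Rightarrow> 'u), 'r) struc)
        (M :: ('r set \<times> nat \<Rightarrow> 'u, 'r) struc) \<pi>.
      (\<And>k. eventually (\<lambda>n. k \<le> \<kappa> n) sequentially \<Longrightarrow> covers sig k \<pi> A M) \<Longrightarrow> is_model M T \<Longrightarrow>
      is_model A T"
  shows "\<exists>p\<in>UNFO ar tau. \<exists>n. un_normal p \<and> card (vars p) \<le> \<kappa> n \<and>
    explicit_definition TYPE('u) ar sig T R xs p"
proof (cases "R \<in> tau")
  case True
  then obtain n where "ar R \<le> \<kappa> n" using wd by blast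
  moreover have "card (vars (Rel R xs)) = ar R" using xs by (simp add: distinct_card)
  moreover have "explicit_definition TYPE('u) ar sig T R xs (Rel R xs)"
    unfolding explicit_definition_def using xs by simp
  moreover have "Rel R xs \<in> UNFO ar tau" using True xs by (auto intro: UNFO.intros)
  ultimately show ?thesis by (intro bexI [of _ "Rel R xs"] exI [of _ n]) (auto simp: un_normal_def)
next
  case notin: False
  show ?thesis
  proof (cases "ar R \<ge> 2")
    case True
    let ?p = "Neg (Ex 0 (Eq 0 0)) :: 'r fm"
    have "\<not> sat M s (Rel R xs) \<and> \<not> sat M s ?p"
      if "is_structure ar sig M" "is_model M T" for M :: "('u, 'r) struc" and s
      using implicitly_defined_empty [OF inf sig T R notin True tau impl that] that(1)
      unfolding is_structure_def by auto
    then have "explicit_definition TYPE('u) ar sig T R xs ?p"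
      unfolding explicit_definition_def using xs by auto
    then show ?thesis
      using UNFO_false \<kappa> [of 0] by (intro bexI [of _ ?p] exI [of _ 0]) (auto simp: un_normal_def)
  next
    case False
    \<comment> \<open>Tests speak about the variable \<open>0\<close>, so a definition is found
      there first and renamed to \<open>xs\<close> at the end.\<close>
    define zs :: "nat list" where "zs = replicate (ar R) 0"
    have "ar R = 0 \<or> ar R = 1" using False by linarith
    then have zs: "distinct zs" "length zs = ar R" "length zs \<le> 1"
      unfolding zs_def by auto
    have "\<exists>p\<in>UNFO ar tau. \<exists>n. un_normal p \<and> vars p \<subseteq> {..<\<kappa> n} \<and>
      explicit_definition TYPE('u) ar sig T R zs p"
    proof (rule ccontr)
      assume nodef: "\<not> ?thesis"
      show False
      proof (rule separated_contradiction [OF inf sig T R notin tau impl, of \<kappa>])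
        fix F n assume F: "finite F" "F \<subseteq> tau"
        \<comment> \<open>A nullary \<open>R\<close> admits only sentences. They are taken one level
          deeper, since \<open>agree_Suc_total\<close> spends a level on finding a pair of agreeing
          points.\<close>
        let ?\<Gamma> = "if ar R = 1 then tests ar F (\<kappa> n) n
          else {g \<in> tests ar F (\<kappa> n) (Suc n). fv g = {}}"
        have \<Gamma>: "finite ?\<Gamma>" using finite_tests [OF F(1)] by (simp del: tests.simps)
        have \<Gamma>_wf: "g \<in> UNFO ar tau \<and> fv g \<subseteq> set zs \<and> vars g \<subseteq> {..<\<kappa> n} \<and>
          un_normal_at False g" if g: "g \<in> ?\<Gamma>" for g
        proof (cases "ar R = 1")
          case True
          with g have "g \<in> tests ar F (\<kappa> n) n" by simp
          from tests_wf [OF \<kappa> F this] show ?thesis using True by (simp add: zs_def)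
        next
          case False
          with g have "g \<in> tests ar F (\<kappa> n) (Suc n)" "fv g = {}" by (simp_all del: tests.simps)
          from tests_wf [OF \<kappa> F this(1)] this(2) show ?thesis by simp
        qed
        have 0: "0 \<in> {..<\<kappa> n}" using \<kappa> [of n] by simp
        define bad where "bad M N s t \<longleftrightarrow> is_structure ar sig M \<and> is_structure ar sig N \<and>
          is_model M T \<and> is_model N T \<and> range s \<subseteq> universe M \<and> range t \<subseteq> universe N \<and>
          (\<forall>g\<in>?\<Gamma>. sat M s g \<longleftrightarrow> sat N t g) \<and> sat M s (Rel R zs) \<and> \<not> sat N t (Rel R zs)"
          for M N :: "('u, 'r) struc" and s t
        have "\<exists>M N s t. bad M N s t"
        proof (rule ccontr)
          assume none: "\<nexists>M N s t. bad M N s t"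
          have "\<exists>p\<in>UNFO ar tau. un_normal p \<and> vars p \<subseteq> {..<\<kappa> n} \<and>
            explicit_definition TYPE('u) ar sig T R zs p"
          proof (rule explicit_definition_if_determined [OF \<Gamma> 0 zs \<Gamma>_wf])
            fix M N :: "('u, 'r) struc" and s t :: "nat \<Rightarrow> 'u"
            assume MN: "is_structure ar sig M" "is_structure ar sig N" "is_model M T" "is_model N T"
              "range s \<subseteq> universe M" "range t \<subseteq> universe N" "sat M s (Rel R zs)"
              and eq: "\<And>g. g \<in> ?\<Gamma> \<Longrightarrow> sat M s g \<longleftrightarrow> sat N t g"
            have "\<forall>g\<in>?\<Gamma>. sat M s g \<longleftrightarrow> sat N t g" by (rule ballI) (rule eq)
            moreover have "\<not> bad M N s t" using none by blast
            ultimately show "sat N t (Rel R zs)" using MN unfolding bad_def by satx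
          qed
          with nodef show False by blast
        qed
        then obtain M N s t where bad: "bad M N s t" by blast
        then have MN: "is_structure ar sig M" "is_structure ar sig N" "is_model M T" "is_model N T"
            "range s \<subseteq> universe M" "range t \<subseteq> universe N"
          and \<Gamma>_eq: "\<And>g. g \<in> ?\<Gamma> \<Longrightarrow> sat M s g \<longleftrightarrow> sat N t g"
          and sR: "sat M s (Rel R zs)" "\<not> sat N t (Rel R zs)"
          unfolding bad_def by blast+
        have ne: "universe M \<noteq> {}" "universe N \<noteq> {}" using MN unfolding is_structure_def by auto
        have "\<exists>a b. a \<in> universe M \<and> b \<in> universe N \<and> agree ar F (\<kappa> n) n M a N b \<and>
          replicate (ar R) a \<in> interp M R \<and> replicate (ar R) b \<notin> interp N R"
        proof (cases "ar R = 1")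
          case True
          have "agree ar F (\<kappa> n) n M (s 0) N (t 0)"
            unfolding agree_def
          proof
            fix g assume g: "g \<in> tests ar F (\<kappa> n) n"
            then have "fv g \<subseteq> {0}" using tests_wf [OF \<kappa> F] by blast
            then have "sat M (\<lambda>_. s 0) g \<longleftrightarrow> sat M s g" "sat N (\<lambda>_. t 0) g \<longleftrightarrow> sat N t g"
              by (auto intro!: sat_cong)
            then show "sat M (\<lambda>_. s 0) g \<longleftrightarrow> sat N (\<lambda>_. t 0) g"
              using \<Gamma>_eq g True by simp
          qed
          moreover have "s 0 \<in> universe M" "t 0 \<in> universe N" using MN(5,6) by auto
          ultimately show ?thesis
            using sR True unfolding zs_def by (intro exI [of _ "s 0"] exI [of _ "t 0"]) simp
        next
          case 0: False
          obtain a where a: "a \<in> universe M" using ne by blast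
          have "sat M s g \<longleftrightarrow> sat N t g" if "g \<in> tests ar F (\<kappa> n) (Suc n)" "fv g = {}" for g
            using \<Gamma>_eq [of g] that 0 by (simp del: tests.simps)
          from agree_Suc_total [OF \<kappa> F(1) ne this a]
          obtain b where "b \<in> universe N" "agree ar F (\<kappa> n) n M a N b" by blast
          moreover have "ar R = 0" using 0 False by simp
          ultimately show ?thesis using a sR unfolding zs_def by auto
        qed
        then obtain a b where ab: "a \<in> universe M \<and> b \<in> universe N \<and> agree ar F (\<kappa> n) n M a N b \<and>
          replicate (ar R) a \<in> interp M R \<and> replicate (ar R) b \<notin> interp N R"
          by (elim exE)
        show "\<exists>(M :: ('u, 'r) struc) (N :: ('u, 'r) struc) a b. is_structure ar sig M \<and> is_structure ar sig N \<and> is_model M T \<and>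
          is_model N T \<and> a \<in> universe M \<and> b \<in> universe N \<and> agree ar F (\<kappa> n) n M a N b \<and>
          replicate (ar R) a \<in> interp M R \<and> replicate (ar R) b \<notin> interp N R"
          using MN ab by blast
      next
        show "\<kappa> n \<ge> 1" for n by (rule \<kappa>)
      next
        fix A :: "(('r set \<times> nat \<Rightarrow> 'u) \<times> ('r set \<times> nat \<Rightarrow> 'u), 'r) struc"
          and M :: "('r set \<times> nat \<Rightarrow> 'u, 'r) struc" and \<pi>
        assume "\<And>k. eventually (\<lambda>n. k \<le> \<kappa> n) sequentially \<Longrightarrow> covers sig k \<pi> A M" "is_model M T"
        then show "is_model A T" by (rule pres)
      qed
    qed
    then obtain p n where p: "p \<in> UNFO ar tau" "un_normal p" "vars p \<subseteq> {..<\<kappa> n}"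
      "explicit_definition TYPE('u) ar sig T R zs p" by blast
    define x where "x = (if xs = [] then 0 else hd xs)"
    have map: "map (transpose 0 x) zs = xs"
      using zs(3) unfolding zs_def x_def xs(2) [symmetric] by (cases xs) auto
    let ?q = "ren (transpose 0 x) p"
    have "card (vars ?q) \<le> card {..<\<kappa> n}"
      unfolding vars_ren using p(3) card_image_le [of "vars p" "transpose 0 x"] card_mono [of "{..<\<kappa> n}" "vars p"]
      by auto
    moreover have "explicit_definition TYPE('u) ar sig T R xs ?q"
      using explicit_definition_ren [OF inj_transpose [of 0 x] p(4)] unfolding map .
    moreover have "?q \<in> UNFO ar tau" by (rule UNFO_ren [OF inj_transpose p(1)])
    moreover have "un_normal ?q"
      using p(2) unfolding un_normal_def un_normal_at_ren [OF inj_transpose] .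
    moreover have "card {..<\<kappa> n} = \<kappa> n" by simp
    ultimately show ?thesis by metis
  qed
qed

theorem theorem3p13:
  fixes ar :: "'r \<Rightarrow> nat" and sig tau :: "'r set" and T :: "'r fm set" and R :: 'r
    and xs :: "nat list"
  assumes "infinite (UNIV :: 'u set)" and "sig \<lesssim> (UNIV :: 'u set)"
    and "UNFO_theory ar sig T"
    and "R \<in> sig" and "tau \<subseteq> sig"
    and "implicitly_defines TYPE('u) ar sig T R tau"
    and "distinct xs" and "length xs = ar R"
  shows "(\<exists>p \<in> UNFO ar tau. explicit_definition TYPE('u) ar sig T R xs p) \<and>
    (\<forall>k\<ge>1. T \<subseteq> UNFO_width ar sig k \<longrightarrow> (R \<in> tau \<longrightarrow> ar R \<le> k) \<longrightarrow>
       (\<exists>p \<in> UNFO_width ar tau k. explicit_definition TYPE('u) ar sig T R xs p))"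
proof (intro conjI allI impI)
  \<comment> \<open>With \<open>\<kappa> = Suc\<close> every width is eventually reached, so
    coverings of all widths are at hand.\<close>
  have "\<exists>p\<in>UNFO ar tau. \<exists>n. un_normal p \<and> card (vars p) \<le> Suc n \<and>
    explicit_definition TYPE('u) ar sig T R xs p"
  proof (rule explicit_definition_exists [OF assms])
    fix A :: "(('r set \<times> nat \<Rightarrow> 'u) \<times> ('r set \<times> nat \<Rightarrow> 'u), 'r) struc"
      and M :: "('r set \<times> nat \<Rightarrow> 'u, 'r) struc" and \<pi>
    assume cov: "\<And>k. eventually (\<lambda>n. k \<le> Suc n) sequentially \<Longrightarrow> covers sig k \<pi> A M"
      and M: "is_model M T"
    have "covers sig k \<pi> A M" for k
      by (rule cov) (auto intro!: eventually_sequentiallyI [of k])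
    then show "is_model A T" using is_model_covers assms(3) M by blast
  qed (auto intro: le_SucI)
  then show "\<exists>p\<in>UNFO ar tau. explicit_definition TYPE('u) ar sig T R xs p" by blast
next
  fix k :: nat assume k: "k \<ge> 1" "T \<subseteq> UNFO_width ar sig k" "R \<in> tau \<longrightarrow> ar R \<le> k"
  \<comment> \<open>With \<open>\<kappa>\<close> constantly \<open>k\<close> the coverings have
    width \<open>k\<close> only, which suffices for sentences of that width. The definition obtained
    is already in normal form, so no pulling step is applied to it.\<close>
  have "\<exists>p\<in>UNFO ar tau. \<exists>n :: nat. un_normal p \<and> card (vars p) \<le> k \<and>
    explicit_definition TYPE('u) ar sig T R xs p"
  proof (rule explicit_definition_exists [OF assms])
    fix A :: "(('r set \<times> nat \<Rightarrow> 'u) \<times> ('r set \<times> nat \<Rightarrow> 'u), 'r) struc"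
      and M :: "('r set \<times> nat \<Rightarrow> 'u, 'r) struc" and \<pi>
    assume cov: "\<And>k'. eventually (\<lambda>n :: nat. k' \<le> k) sequentially \<Longrightarrow> covers sig k' \<pi> A M"
      and M: "is_model M T"
    have "covers sig k \<pi> A M" by (rule cov) simp
    then show "is_model A T" using is_model_covers_width [OF _ k(1) assms(3) k(2) M] by blast
  qed (use k in auto)
  then show "\<exists>p\<in>UNFO_width ar tau k. explicit_definition TYPE('u) ar sig T R xs p"
    unfolding UNFO_width_def has_width_def by blast
qed

end
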